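(* If $X$ and $Y$ are skew Sturmian subshifts, that is, subshifts generated by skew Sturmian sequences in $\{0,1\}^{\mathbb Z}$, then $X$ and $Y$ are flow equivalent.
   Context: The alphabet is $\mathcal A=\{0,1\}$; $\mathcal A^{\mathbb Z}$ is the space of bi-infinite sequences with the product topology and the shift is $\sigma(x)_i=x_{i+1}$. Sequences $x,y$ are similar if $\sigma^k(x)=y$ for some $k\in\mathbb Z$. A sequence is periodic if $\sigma^N(x)=x$ for some $N>0$. The subshift generated by $x$ is the closure of $\{\sigma^k(x):k\in\mathbb Z\}$. Cell-series: a sequence $x$ is written as a bi-infinite concatenation $\cdots B_{-1}B_0B_1\cdots$ where each cell $B_i$ is a word consisting of the symbol $1$ followed by a (possibly empty) string of $0$'s. An $n$-chain is a word of the form $B_r\cdots B_s$ with $n=s-r+1\ge 1$. The sequence $x$ is Sturmian if for every $m>0$ the numbers of $0$'s in any two $m$-chains of $x$ differ by at most one. If $b_n$ denotes the number of $0$'s in an $n$-chain, the limit $\lim_{n\to\infty} b_n/n$ exists and is called the frequency of $x$. A skew Sturmian sequence is a non-periodic Sturmian sequence with rational frequency; by convention the sequence $\cdots0001000\cdots$ (frequency $\infty$) is also counted as skew Sturmian. By a theorem of Morse and Hedlund (taken as known), up to similarity every skew Sturmian sequence of positive rational frequency $\alpha=q/p$ ($p,q$ relatively prime positive integers) has one of the following cell-series, where $m\in\mathbb Z$, $\beta=p/q$ and $G=\{m+k\beta:k\in\mathbb Z\}$: $S(m,\alpha)$, in which the number of $0$'s in $B_n$ is the number of points $z\in G$ with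 $n<z\le n+1$ if $n<m$, with $m<z<m+1$ if $n=m$, and with $n\le z<n+1$ if $n>m$; or $S'(m,\alpha)$, in which the number of $0$'s in $B_n$ is the number of points $z\in G$ with $n\le z<n+1$ if $n<m$, with $m\le z\le m+1$ if $n=m$, and with $n<z\le n+1$ if $n>m$. The skew Sturmian sequence of frequency $0$ is, up to similarity, $\cdots1110111\cdots$. For a subshift $X$, its suspension is $\Sigma X=(X\times\mathbb R)/\sim$, where $(x,s)\sim(y,t)$ when $y=\sigma^n(x)$ and $t=s-n$ for some $n\in\mathbb Z$; the class of $(x,s)$ is written $[x,s]$. The natural flow on $\Sigma X$ is $[x,s]\mapsto[x,s+t]$, $t\in\mathbb R$, and its orbits are the flow lines. Two subshifts $X$ and $Y$ are flow equivalent if there is a homeomorphism $\Sigma X\to\Sigma Y$ mapping flow lines to flow lines and preserving their orientation. *)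

theory Defs
  imports "HOL-Analysis.Analysis"
begin

section \<open>Bi-infinite binary sequences and subshifts\<close>

text \<open>The symbols 0 and 1 are \<^term>\<open>False\<close> and \<^term>\<open>True\<close>. The type class topology on
  \<^typ>\<open>int \<Rightarrow> bool\<close> is the product of the discrete topologies on \<^typ>\<open>bool\<close>.\<close>

type_synonym sequence = "int \<Rightarrow> bool"

definition shift :: "sequence \<Rightarrow> sequence" where
  "shift x = (\<lambda>i. x (i + 1))"

text \<open>Integer powers of the shift, see the lemmas below.\<close>

definition shift_pow :: "int \<Rightarrow> sequence \<Rightarrow> sequence" where
  "shift_pow k x = (\<lambda>i. x (i + k))"

lemma shift_pow_of_nat: "shift_pow (int n) = shift ^^ n"
  by (induction n) (auto simp: shift_pow_def shift_def fun_eq_iff algebra_simps)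

lemma shift_pow_add: "shift_pow (k + l) x = shift_pow k (shift_pow l x)"
  by (simp add: shift_pow_def ac_simps)

definition similar :: "sequence \<Rightarrow> sequence \<Rightarrow> bool" where
  "similar x y \<longleftrightarrow> (\<exists>k. shift_pow k x = y)"

definition periodic :: "sequence \<Rightarrow> bool" where
  "periodic x \<longleftrightarrow> (\<exists>N>0. (shift ^^ N) x = x)"

definition generated_subshift :: "sequence \<Rightarrow> sequence set" where
  "generated_subshift x = closure (range (\<lambda>k. shift_pow k x))"

section \<open>Skew Sturmian sequences\<close>

text \<open>The word \<open>x\<^sub>i x\<^sub>i\<^sub>+\<^sub>1 \<dots> x\<^sub>j\<^sub>-\<^sub>1\<close>.\<close>

definition factor :: "sequence \<Rightarrow> int \<Rightarrow> int \<Rightarrow> bool list" where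
  "factor x i j = map x [i..j - 1]"

definition is_cell :: "bool list \<Rightarrow> bool" where
  "is_cell w \<longleftrightarrow> (\<exists>k. w = True # replicate k False)"

text \<open>A decomposition of \<open>x\<close> into cells is given by the starting positions \<open>p i\<close> of the cells
  \<open>B\<^sub>i\<close>; strict monotonicity makes the cells cover all integer positions exactly once.\<close>

definition cell :: "sequence \<Rightarrow> (int \<Rightarrow> int) \<Rightarrow> int \<Rightarrow> bool list" where
  "cell x p i = factor x (p i) (p (i + 1))"

definition cell_series :: "sequence \<Rightarrow> (int \<Rightarrow> int) \<Rightarrow> bool" where
  "cell_series x p \<longleftrightarrow> strict_mono p \<and> (\<forall>i. is_cell (cell x p i))"

definition is_chain :: "sequence \<Rightarrow> nat \<Rightarrow> bool list \<Rightarrow> bool" where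
  "is_chain x n w \<longleftrightarrow> n \<ge> 1 \<and>
     (\<exists>p r s. cell_series x p \<and> int n = s - r + 1 \<and> w = concat (map (cell x p) [r..s]))"

definition zeros :: "bool list \<Rightarrow> nat" where
  "zeros w = count_list w False"

definition sturmian :: "sequence \<Rightarrow> bool" where
  "sturmian x \<longleftrightarrow> (\<exists>p. cell_series x p) \<and>
     (\<forall>m>0. \<forall>u v. is_chain x m u \<and> is_chain x m v \<longrightarrow> \<bar>int (zeros u) - int (zeros v)\<bar> \<le> 1)"

text \<open>The limit is required for every choice of one \<open>n\<close>-chain for each \<open>n \<ge> 1\<close>. This is
  meaningful only for sequences that have a cell-series.\<close>

definition has_frequency :: "sequence \<Rightarrow> real \<Rightarrow> bool" where
  "has_frequency x \<alpha> \<longleftrightarrow>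
     (\<forall>w. (\<forall>n\<ge>1. is_chain x n (w n)) \<longrightarrow> (\<lambda>n. real (zeros (w n)) / real n) \<longlonglongrightarrow> \<alpha>)"

text \<open>The second alternative is the conventional case of frequency \<open>\<infinity>\<close>: a single symbol 1
  (such a sequence has no cell-series).\<close>

definition skew_sturmian :: "sequence \<Rightarrow> bool" where
  "skew_sturmian x \<longleftrightarrow>
     (sturmian x \<and> \<not> periodic x \<and> (\<exists>\<alpha>\<in>\<rat>. has_frequency x \<alpha>)) \<or>
     similar x (\<lambda>i. i = 0)"

definition skew_sturmian_subshift :: "sequence set \<Rightarrow> bool" where
  "skew_sturmian_subshift X \<longleftrightarrow> (\<exists>x. skew_sturmian x \<and> X = generated_subshift x)"

section \<open>Suspensions and flow equivalence\<close>

definition suspension_rel :: "sequence set \<Rightarrow> ((sequence \<times> real) \<times> (sequence \<times> real)) set" where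
  "suspension_rel X = {((x, s), (y, t)). x \<in> X \<and> y \<in> X \<and>
     (\<exists>n::int. y = shift_pow n x \<and> t = s - of_int n)}"

lemma equiv_suspension_rel: "equiv (X \<times> UNIV) (suspension_rel X)"
proof (rule equivI)
  show "suspension_rel X \<subseteq> (X \<times> UNIV) \<times> (X \<times> UNIV)"
    by (auto simp: suspension_rel_def)
  show "refl_on (X \<times> UNIV) (suspension_rel X)"
    by (auto simp: refl_on_def suspension_rel_def shift_pow_def intro!: exI[of _ 0])
  show "sym (suspension_rel X)"
  proof (rule symI, clarify)
    fix x s y t assume "((x, s), (y, t)) \<in> suspension_rel X"
    then obtain n where "x \<in> X" "y \<in> X" "y = shift_pow n x" "t = s - of_int n"
      by (auto simp: suspension_rel_def)
    then have "x = shift_pow (- n) y" "s = t - of_int (- n)"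
      by (simp_all add: shift_pow_def)
    with \<open>x \<in> X\<close> \<open>y \<in> X\<close> show "((y, t), (x, s)) \<in> suspension_rel X"
      unfolding suspension_rel_def by blast
  qed
  show "trans (suspension_rel X)"
  proof (rule transI, clarify)
    fix x s y t z u
    assume "((x, s), (y, t)) \<in> suspension_rel X" "((y, t), (z, u)) \<in> suspension_rel X"
    then obtain n m where "x \<in> X" "z \<in> X" "y = shift_pow n x" "t = s - of_int n"
        "z = shift_pow m y" "u = t - of_int m"
      by (auto simp: suspension_rel_def)
    then have "z = shift_pow (m + n) x" "u = s - of_int (m + n)"
      by (simp_all add: shift_pow_add)
    with \<open>x \<in> X\<close> \<open>z \<in> X\<close> show "((x, s), (z, u)) \<in> suspension_rel X"
      unfolding suspension_rel_def by blast
  qed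
qed

definition suspension_class :: "sequence set \<Rightarrow> sequence \<times> real \<Rightarrow> (sequence \<times> real) set" where
  "suspension_class X a = suspension_rel X `` {a}"

definition suspension :: "sequence set \<Rightarrow> (sequence \<times> real) set set" where
  "suspension X = (X \<times> UNIV) // suspension_rel X"

lemma suspension_eq: "suspension X = suspension_class X ` (X \<times> UNIV)"
  by (auto simp: suspension_def suspension_class_def quotient_def)

text \<open>The quotient topology; the lemmas after the definition confirm that it is one.\<close>

definition suspension_topology :: "sequence set \<Rightarrow> (sequence \<times> real) set topology" where
  "suspension_topology X = topology (\<lambda>U. U \<subseteq> suspension X \<and>
     openin (top_of_set (X \<times> UNIV)) {a \<in> X \<times> UNIV. suspension_class X a \<in> U})"

lemma openin_suspension_topology:
  "openin (suspension_topology X) U \<longleftrightarrow> U \<subseteq> suspension X \<and>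
     openin (top_of_set (X \<times> UNIV)) {a \<in> X \<times> UNIV. suspension_class X a \<in> U}"
proof -
  let ?pre = "\<lambda>U. {a \<in> X \<times> UNIV. suspension_class X a \<in> U}"
  have "istopology (\<lambda>U. U \<subseteq> suspension X \<and> openin (top_of_set (X \<times> UNIV)) (?pre U))"
    unfolding istopology_def
  proof (intro conjI allI impI)
    fix S T
    assume S: "S \<subseteq> suspension X \<and> openin (top_of_set (X \<times> UNIV)) (?pre S)"
      and T: "T \<subseteq> suspension X \<and> openin (top_of_set (X \<times> UNIV)) (?pre T)"
    show "S \<inter> T \<subseteq> suspension X" using S by blast
    have "?pre (S \<inter> T) = ?pre S \<inter> ?pre T" by blast
    then show "openin (top_of_set (X \<times> UNIV)) (?pre (S \<inter> T))"
      using S T by (simp only: openin_Int)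
  next
    fix K
    assume K: "\<forall>S\<in>K. S \<subseteq> suspension X \<and> openin (top_of_set (X \<times> UNIV)) (?pre S)"
    show "\<Union>K \<subseteq> suspension X" using K by blast
    have "?pre (\<Union>K) = (\<Union>S\<in>K. ?pre S)" by blast
    moreover have "openin (top_of_set (X \<times> UNIV)) (\<Union>S\<in>K. ?pre S)"
      using K by (intro openin_Union) blast
    ultimately show "openin (top_of_set (X \<times> UNIV)) (?pre (\<Union>K))" by simp
  qed
  then show ?thesis
    by (simp add: suspension_topology_def topology_inverse')
qed

lemma topspace_suspension_topology: "topspace (suspension_topology X) = suspension X"
proof
  show "topspace (suspension_topology X) \<subseteq> suspension X"
    using openin_suspension_topology openin_topspace by blast
  have "{a \<in> X \<times> UNIV. suspension_class X a \<in> suspension X} = X \<times> UNIV"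
    by (auto simp: suspension_eq)
  then have "openin (suspension_topology X) (suspension X)"
    by (simp add: openin_suspension_topology openin_topspace[of "top_of_set (X \<times> UNIV)", simplified])
  then show "suspension X \<subseteq> topspace (suspension_topology X)"
    by (rule openin_subset)
qed

lemma quotient_map_suspension_class:
  "quotient_map (top_of_set (X \<times> UNIV)) (suspension_topology X) (suspension_class X)"
  by (auto simp: quotient_map_def topspace_suspension_topology suspension_eq
      openin_suspension_topology)

text \<open>The natural flow \<open>[x, s] \<mapsto> [x, s + t]\<close>, on equivalence classes; it is evaluated on
  representatives in the lemma below.\<close>

definition suspension_flow ::
  "sequence set \<Rightarrow> real \<Rightarrow> (sequence \<times> real) set \<Rightarrow> (sequence \<times> real) set" where
  "suspension_flow X t c = (\<Union>(x, s)\<in>c. suspension_class X (x, s + t))"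

lemma suspension_flow_class:
  assumes "x \<in> X"
  shows "suspension_flow X t (suspension_class X (x, s)) = suspension_class X (x, s + t)"
proof -
  have "suspension_class X (y, u + t) = suspension_class X (x, s + t)"
    if "(y, u) \<in> suspension_class X (x, s)" for y u
  proof -
    from that have "((x, s + t), (y, u + t)) \<in> suspension_rel X"
      by (auto simp: suspension_class_def suspension_rel_def)
    then show ?thesis
      unfolding suspension_class_def using equiv_class_eq[OF equiv_suspension_rel] by metis
  qed
  moreover have "(x, s) \<in> suspension_class X (x, s)"
    using equiv_class_self[OF equiv_suspension_rel] assms
    by (simp add: suspension_class_def)
  ultimately show ?thesis
    unfolding suspension_flow_def by fast
qed

definition flow_lines :: "sequence set \<Rightarrow> (sequence \<times> real) set set set" where
  "flow_lines X = (\<lambda>c. range (\<lambda>t. suspension_flow X t c)) ` suspension X"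

text \<open>Orientation is preserved when along each flow line the map is, in terms of the flow
  parameters (lifted to the real line when the flow line is closed), continuous and increasing.\<close>

definition preserves_orientation ::
  "sequence set \<Rightarrow> sequence set \<Rightarrow> ((sequence \<times> real) set \<Rightarrow> (sequence \<times> real) set) \<Rightarrow> bool" where
  "preserves_orientation X Y h \<longleftrightarrow> (\<forall>c\<in>suspension X. \<exists>\<theta>::real \<Rightarrow> real.
     continuous_on UNIV \<theta> \<and> strict_mono \<theta> \<and>
     (\<forall>t. h (suspension_flow X t c) = suspension_flow Y (\<theta> t) (h c)))"

definition flow_equivalent :: "sequence set \<Rightarrow> sequence set \<Rightarrow> bool" where
  "flow_equivalent X Y \<longleftrightarrow>
     (\<exists>h. homeomorphic_map (suspension_topology X) (suspension_topology Y) h \<and>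
          (\<forall>L\<in>flow_lines X. h ` L \<in> flow_lines Y) \<and>
          preserves_orientation X Y h)"

end

theory Submission
  imports Defs
begin

text \<open>A skew Sturmian sequence \<open>x\<close> agrees far to the right and far to the left with shifts of one and
  the same periodic sequence \<open>P\<close>, so its subshift consists of the orbit of \<open>x\<close> and the finite orbit
  of \<open>P\<close>, and its suspension is a circle together with one flow line that spirals onto the circle in
  both directions. Two such suspensions are identified by rescaling the circles to each other and
  reparametrizing the spiralling lines so that the phases match near both ends.

  For the agreement with \<open>P\<close>: if \<open>p\<^sub>r\<close> is the position of the \<open>r\<close>-th symbol 1 and
  \<open>A/B\<close> is the frequency plus one in lowest terms, then \<open>B p\<^sub>r - A r\<close> is an integer whose
  oscillation is at most \<open>B\<close>. It is therefore eventually constant along each residue class modulo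
  \<open>B\<close>, which forces \<open>p\<^sub>r = \<lfloor>A (r + a) / B\<rfloor> + t\<close> near each end.\<close>

section \<open>Windows and shifts\<close>

text \<open>Cylinder neighbourhoods: the windows around 0 give a base of the product topology at
  \<open>z\<close>. A negative \<open>m\<close> makes the condition vacuous, so no sign hypotheses
  are needed for it.\<close>

definition agree :: "int \<Rightarrow> sequence \<Rightarrow> sequence \<Rightarrow> bool" where
  "agree m z w \<longleftrightarrow> (\<forall>i. \<bar>i\<bar> \<le> m \<longrightarrow> z i = w i)"

lemma agree_mono: "agree m z w \<Longrightarrow> n \<le> m \<Longrightarrow> agree n z w"
  by (auto simp: agree_def)

lemma open_agree: "open {w. agree m z w}"
proof -
  have "{w. agree m z w} = {w. \<forall>i\<in>{-m..m}. w (id i) \<in> {z i}}"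
    by (auto simp: agree_def abs_le_iff)
  moreover have "open {w. \<forall>i\<in>{-m..m}. w (id i) \<in> {z i}}"
    by (intro product_topology_basis' open_discrete) auto
  ultimately show ?thesis by simp
qed

text \<open>A basic open set of the product topology restricts only finitely many coordinates, and
  \<open>m\<close> bounds their absolute values.\<close>

lemma open_contains_agree:
  assumes "open U" "z \<in> U"
  shows "\<exists>m. \<forall>w. agree m z w \<longrightarrow> w \<in> U"
proof -
  obtain V where V: "z \<in> Pi\<^sub>E UNIV V" "finite {i. V i \<noteq> UNIV}" "Pi\<^sub>E UNIV V \<subseteq> U"
    using product_topology_open_contains_basis[of "\<lambda>_. euclidean" UNIV U z] assms
    by (auto simp: open_fun_def)
  have "finite (abs ` {i. V i \<noteq> UNIV})" using V(2) by simp
  then obtain m where m: "\<And>i. V i \<noteq> UNIV \<Longrightarrow> \<bar>i\<bar> \<le> m"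
    using bdd_above_finite[of "abs ` {i. V i \<noteq> UNIV}"] by (auto simp: bdd_above_def)
  have "w \<in> U" if w: "agree m z w" for w
  proof -
    have "w i \<in> V i" for i
      using w m[of i] V(1) by (cases "V i = UNIV") (force simp: agree_def)+
    then show ?thesis using V(3) by auto
  qed
  then show ?thesis by blast
qed

lemma closure_iff_agree: "z \<in> closure S \<longleftrightarrow> (\<forall>m. \<exists>w\<in>S. agree m z w)"
proof
  assume z: "z \<in> closure S"
  show "\<forall>m. \<exists>w\<in>S. agree m z w"
  proof
    fix m
    have "z \<in> {w. agree m z w}" by (simp add: agree_def)
    then show "\<exists>w\<in>S. agree m z w"
      using z open_agree[of m z] unfolding closure_iff_nhds_not_empty by blast
  qed
next
  assume *: "\<forall>m. \<exists>w\<in>S. agree m z w"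
  show "z \<in> closure S"
    unfolding closure_iff_nhds_not_empty
    using * open_contains_agree by (metis disjoint_iff subsetD)
qed

lemma finite_separation:
  assumes "finite F" "z \<notin> F"
  shows "\<exists>m. \<forall>w\<in>F. \<not> agree m z w"
  using assms
proof (induction rule: finite_induct)
  case (insert w F)
  then obtain m where m: "\<forall>v\<in>F. \<not> agree m z v" by auto
  obtain i where "z i \<noteq> w i" using insert.prems by fastforce
  then have "\<not> agree (max m \<bar>i\<bar>) z w" using max.cobounded2 unfolding agree_def by blast
  moreover have "\<forall>v\<in>F. \<not> agree (max m \<bar>i\<bar>) z v"
    using m agree_mono by (meson max.cobounded1)
  ultimately show ?case by blast
qed simp

section \<open>Shift powers and suspension classes\<close>

lemma shift_pow_apply: "shift_pow k x i = x (i + k)"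
  by (simp add: shift_pow_def)

lemma shift_pow_0 [simp]: "shift_pow 0 x = x"
  by (simp add: shift_pow_def)

lemma shift_pow_shift_pow: "shift_pow k (shift_pow l x) = shift_pow (k + l) x"
  by (simp add: shift_pow_add)

lemma shift_pow_eq_iff: "shift_pow j x = shift_pow k y \<longleftrightarrow> shift_pow (j - k) x = y"
proof
  assume "shift_pow j x = shift_pow k y"
  then have "shift_pow (- k) (shift_pow j x) = shift_pow (- k) (shift_pow k y)" by simp
  then show "shift_pow (j - k) x = y" by (simp add: shift_pow_shift_pow)
qed (auto simp: shift_pow_shift_pow)

lemma generated_subshift_shift:
  "generated_subshift (shift_pow k x) = generated_subshift x"
proof -
  have "range (\<lambda>j. shift_pow j (shift_pow k x)) = (\<lambda>j. shift_pow j x) ` range (\<lambda>j. j + k)"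
    by (simp only: shift_pow_shift_pow image_image)
  also have "range (\<lambda>j::int. j + k) = UNIV" by simp
  finally show ?thesis by (simp only: generated_subshift_def)
qed

lemma suspension_class_eq_iff:
  assumes "x \<in> X" "y \<in> X"
  shows "suspension_class X (x, s) = suspension_class X (y, t) \<longleftrightarrow>
    (\<exists>n. y = shift_pow n x \<and> t = s - of_int n)"
  unfolding suspension_class_def
  using eq_equiv_class_iff[OF equiv_suspension_rel, of "(x, s)" X "(y, t)"] assms
  by (simp add: suspension_rel_def)

lemma suspension_class_shift:
  assumes "x \<in> X" "shift_pow n x \<in> X"
  shows "suspension_class X (shift_pow n x, s) = suspension_class X (x, s + of_int n)"
  using suspension_class_eq_iff[OF assms, of "s + of_int n" s] by auto

section \<open>Homoclinic sequences\<close>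

text \<open>The right tail is normalized to phase 0, so \<open>b\<close> is the whole phase shift
  between the two ends. Stating \<open>period\<close> as an equivalence makes \<open>N\<close> the
  least period, hence the circumference of the circle in the suspension.\<close>

locale homoclinic =
  fixes x P :: sequence and N b K :: int
  assumes N_pos: "N > 0"
    and period: "shift_pow k P = P \<longleftrightarrow> N dvd k"
    and right: "K \<le> i \<Longrightarrow> x i = P i"
    and left: "i \<le> - K \<Longrightarrow> x i = P (i + b)"
    and aperiodic: "shift_pow k x = x \<Longrightarrow> k = 0"
begin

abbreviation X :: "sequence set" where
  "X \<equiv> generated_subshift x"

lemma P_add: "N dvd k \<Longrightarrow> P (i + k) = P i"
  using period[of k] by (metis shift_pow_apply)

lemma shift_P_eq_iff: "shift_pow j P = shift_pow k P \<longleftrightarrow> N dvd j - k"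
  by (simp add: shift_pow_eq_iff period)

lemma shift_x_eq_iff: "shift_pow j x = shift_pow k x \<longleftrightarrow> j = k"
  using aperiodic[of "j - k"] by (auto simp: shift_pow_eq_iff)

lemma shift_x_neq_P: "shift_pow j x \<noteq> shift_pow k P"
proof
  assume "shift_pow j x = shift_pow k P"
  then have *: "shift_pow (j - k) x = P" by (simp add: shift_pow_eq_iff)
  have "shift_pow N P = P" by (simp add: period)
  then have "shift_pow (N + (j - k)) x = shift_pow (j - k) x"
    using * by (metis shift_pow_add)
  then show False using N_pos by (simp add: shift_x_eq_iff)
qed

text \<open>One full period determines the phase: every index reduces modulo \<open>N\<close> to the
  window.\<close>

lemma shift_P_eqI:
  assumes "\<And>i. 0 \<le> i \<Longrightarrow> i < N \<Longrightarrow> P (i + j) = P (i + k)"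
  shows "N dvd j - k"
proof -
  have "P (i + j) = P (i + k)" for i
  proof -
    have e: "i + l = (i mod N + l) + N * (i div N)" for l
      by (simp add: minus_mod_eq_mult_div [symmetric])
    have "P (i + l) = P (i mod N + l)" for l
      by (metis e P_add dvd_triv_left)
    then show ?thesis using assms[of "i mod N"] N_pos by simp
  qed
  then have "shift_pow j P = shift_pow k P" by (auto simp: shift_pow_def)
  then show ?thesis by (simp add: shift_P_eq_iff)
qed

lemma finite_orbit_P: "finite (range (\<lambda>k. shift_pow k P))"
proof -
  have "shift_pow k P = shift_pow (k mod N) P" for k
    unfolding shift_P_eq_iff by (simp add: minus_mod_eq_mult_div)
  then have "range (\<lambda>k. shift_pow k P) \<subseteq> (\<lambda>k. shift_pow k P) ` {0..<N}"
    using N_pos by (auto intro!: rev_image_eqI[of "_ mod N"])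
  then show ?thesis by (rule finite_subset) simp
qed

text \<open>A window of radius \<open>m\<close> centred at such a \<open>j\<close> lies inside one
  tail, where \<open>x\<close> reads a shift of \<open>P\<close>.\<close>

lemma agree_far:
  assumes "K + m \<le> \<bar>j\<bar>"
  shows "\<exists>k. agree m (shift_pow j x) (shift_pow k P)"
proof (cases "0 \<le> j")
  case True
  then have "agree m (shift_pow j x) (shift_pow j P)"
    using assms by (auto simp: agree_def shift_pow_apply intro!: right)
  then show ?thesis by blast
next
  case False
  then have "agree m (shift_pow j x) (shift_pow (j + b) P)"
    using assms by (auto simp: agree_def shift_pow_apply left ac_simps)
  then show ?thesis by blast
qed

text \<open>Points off the periodic orbit are isolated. A window that excludes the finite orbit of
  \<open>P\<close> also excludes all far shifts of \<open>x\<close>, which look like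
  \<open>P\<close> there; the finitely many remaining shifts are excluded by enlarging the
  window.\<close>

lemma separation:
  assumes "z \<notin> range (\<lambda>k. shift_pow k P)"
  shows "\<exists>m. (\<forall>k. \<not> agree m z (shift_pow k P)) \<and>
    (\<forall>j. agree m z (shift_pow j x) \<longrightarrow> shift_pow j x = z)"
proof -
  obtain m where m: "\<And>k. \<not> agree m z (shift_pow k P)"
    using finite_separation[OF finite_orbit_P assms] by blast
  define F where "F = (\<lambda>j. shift_pow j x) ` {- (K + m)..K + m} - {z}"
  obtain n where n: "\<And>w. w \<in> F \<Longrightarrow> \<not> agree n z w"
    using finite_separation[of F z] by (auto simp: F_def)
  have "shift_pow j x = z" if "agree (max m n) z (shift_pow j x)" for j
  proof (rule ccontr)
    assume neq: "shift_pow j x \<noteq> z"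
    have "agree m z (shift_pow j x)" "agree n z (shift_pow j x)"
      using that by (auto intro: agree_mono)
    then have "shift_pow j x \<notin> F" using n by blast
    with neq have "\<not> \<bar>j\<bar> \<le> K + m" by (force simp: F_def)
    then obtain k where "agree m (shift_pow j x) (shift_pow k P)"
      using agree_far[of m j] by auto
    with \<open>agree m z (shift_pow j x)\<close> have "agree m z (shift_pow k P)"
      by (simp add: agree_def)
    with m show False by blast
  qed
  moreover have "\<not> agree (max m n) z (shift_pow k P)" for k
    using m agree_mono[of "max m n" z "shift_pow k P" m] by auto
  ultimately show ?thesis by blast
qed

text \<open>Near a point of the periodic orbit, shifts of \<open>x\<close> occur only far out and
  with the matching phase. Excluding finitely many middle shifts forces the distance; a window
  containing a full period forces the phase.\<close>

lemma separation_P: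
  "\<exists>m. (\<forall>j. agree m (shift_pow k P) (shift_pow j P) \<longrightarrow> N dvd j - k) \<and>
    (\<forall>j. agree m (shift_pow k P) (shift_pow j x) \<longrightarrow>
      J \<le> j \<and> N dvd j - k \<or> j \<le> - J \<and> N dvd j + b - k)"
proof -
  \<comment> \<open>Beyond \<open>\<bar>K\<bar> + N\<close> the window \<open>0..<N\<close> placed
    at \<open>j\<close> lies entirely in one tail.\<close>
  define L where "L = max J (\<bar>K\<bar> + N)"
  define F where "F = (\<lambda>j. shift_pow j x) ` {- L..L}"
  have "shift_pow k P \<notin> F" using shift_x_neq_P by (auto simp: F_def) metis
  then obtain n where n: "\<And>w. w \<in> F \<Longrightarrow> \<not> agree n (shift_pow k P) w"
    using finite_separation[of F "shift_pow k P"] by (auto simp: F_def simp del: ball_simps)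
  define m where "m = max n N"
  have mN: "w i = P (i + k)" if "agree m (shift_pow k P) w" "0 \<le> i" "i < N" for w i
    using that by (auto simp: agree_def m_def shift_pow_apply)
  have "N dvd j - k" if "agree m (shift_pow k P) (shift_pow j P)" for j
    using mN[OF that] by (intro shift_P_eqI) (simp add: shift_pow_apply)
  moreover have "J \<le> j \<and> N dvd j - k \<or> j \<le> - J \<and> N dvd j + b - k"
    if j: "agree m (shift_pow k P) (shift_pow j x)" for j
  proof -
    have "agree n (shift_pow k P) (shift_pow j x)"
      using j by (auto simp: m_def intro: agree_mono)
    then have "shift_pow j x \<notin> F" using n by blast
    then have "L < j \<or> j < - L" by (force simp: F_def)
    then show ?thesis
    proof
      assume "L < j"
      then have "K \<le> i + j" if "0 \<le> i" for i using that N_pos by (auto simp: L_def)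
      then have "P (i + j) = P (i + k)" if "0 \<le> i" "i < N" for i
        using mN[OF j that] right[of "i + j"] that by (simp add: shift_pow_apply)
      then have "N dvd j - k" by (rule shift_P_eqI)
      then show ?thesis using \<open>L < j\<close> by (auto simp: L_def)
    next
      assume "j < - L"
      then have "i + j \<le> - K" if "i < N" for i using that by (auto simp: L_def)
      then have "P (i + (j + b)) = P (i + k)" if "0 \<le> i" "i < N" for i
        using mN[OF j that] left[of "i + j"] that by (simp add: shift_pow_apply ac_simps)
      then have "N dvd j + b - k" by (rule shift_P_eqI)
      then show ?thesis using \<open>j < - L\<close> by (auto simp: L_def)
    qed
  qed
  ultimately show ?thesis by blast
qed

text \<open>A limit point off the orbit of \<open>P\<close> is isolated, so a shift of
  \<open>x\<close> approximating it must equal it. Conversely, shifts of \<open>x\<close> by large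
  multiples of \<open>N\<close> converge to the points of the periodic orbit.\<close>

lemma subshift_eq: "X = range (\<lambda>k. shift_pow k x) \<union> range (\<lambda>k. shift_pow k P)"
proof (intro equalityI subsetI)
  fix z assume z: "z \<in> X"
  show "z \<in> range (\<lambda>k. shift_pow k x) \<union> range (\<lambda>k. shift_pow k P)"
  proof (cases "z \<in> range (\<lambda>k. shift_pow k P)")
    case False
    then obtain m where "\<forall>j. agree m z (shift_pow j x) \<longrightarrow> shift_pow j x = z"
      using separation by blast
    moreover obtain j where "agree m z (shift_pow j x)"
      using z unfolding generated_subshift_def closure_iff_agree by blast
    ultimately have "shift_pow j x = z" by blast
    then show ?thesis by blast
  qed simp
next
  fix z assume "z \<in> range (\<lambda>k. shift_pow k x) \<union> range (\<lambda>k. shift_pow k P)"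
  then show "z \<in> X"
  proof
    assume "z \<in> range (\<lambda>k. shift_pow k x)"
    then show ?thesis
      using closure_subset[of "range (\<lambda>k. shift_pow k x)"] by (auto simp: generated_subshift_def)
  next
    assume "z \<in> range (\<lambda>k. shift_pow k P)"
    then obtain k where k: "z = shift_pow k P" by blast
    have "\<exists>w\<in>range (\<lambda>k. shift_pow k x). agree m z w" for m
    proof -
      \<comment> \<open>Large enough that moving the window by \<open>k + N * q\<close> puts it into
        the right tail, while a multiple of \<open>N\<close> leaves the phase of \<open>P\<close>
        unchanged.\<close>
      define q where "q = \<bar>K\<bar> + \<bar>m\<bar> + \<bar>k\<bar>"
      have "q \<le> N * q" using N_pos by (auto simp: q_def mult_le_cancel_right1)
      then have "x (i + (k + N * q)) = P (i + k)" if "\<bar>i\<bar> \<le> m" for i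
        using that right[of "i + (k + N * q)"] P_add[of "N * q" "i + k"]
        by (simp add: q_def ac_simps)
      then have "agree m z (shift_pow (k + N * q) x)"
        by (simp add: agree_def k shift_pow_apply)
      then show ?thesis by blast
    qed
    then show ?thesis by (simp add: generated_subshift_def closure_iff_agree)
  qed
qed

lemma shift_x_in [simp]: "shift_pow k x \<in> X" and shift_P_in [simp]: "shift_pow k P \<in> X"
  by (auto simp: subshift_eq)

lemma x_in [simp]: "x \<in> X" and P_in [simp]: "P \<in> X"
  using shift_x_in[of 0] shift_P_in[of 0] by simp_all

section \<open>The suspension as a line and a circle\<close>

lemma class_shift_x:
  "suspension_class X (shift_pow k x, s) = suspension_class X (x, s + of_int k)"
  by (simp add: suspension_class_shift)

lemma class_shift_P:
  "suspension_class X (shift_pow k P, s) = suspension_class X (P, s + of_int k)"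
  by (simp add: suspension_class_shift)

text \<open>Aperiodicity makes \<open>s\<close> a global coordinate on the flow line of
  \<open>x\<close>.\<close>

lemma class_x_eq_iff: "suspension_class X (x, s) = suspension_class X (x, t) \<longleftrightarrow> s = t"
proof
  assume "suspension_class X (x, s) = suspension_class X (x, t)"
  then obtain n where "x = shift_pow n x" "t = s - of_int n"
    by (auto simp: suspension_class_eq_iff)
  then show "s = t" using aperiodic[of n] by simp
qed simp

lemma class_x_neq_P: "suspension_class X (x, s) \<noteq> suspension_class X (P, t)"
proof
  assume "suspension_class X (x, s) = suspension_class X (P, t)"
  then obtain n where "P = shift_pow n x"
    by (auto simp: suspension_class_eq_iff)
  then show False using shift_x_neq_P[of n 0] by simp
qed

text \<open>The flow line of \<open>P\<close> is a circle of circumference \<open>N\<close>.\<close>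

lemma class_P_eq_iff:
  "suspension_class X (P, s) = suspension_class X (P, t) \<longleftrightarrow> (\<exists>n. t = s - of_int (N * n))"
proof -
  have "P = shift_pow n P \<longleftrightarrow> N dvd n" for n using period[of n] by metis
  then show ?thesis by (auto simp: suspension_class_eq_iff dvd_def)
qed

lemma suspension_cases:
  assumes "c \<in> suspension X"
  obtains (x) s where "c = suspension_class X (x, s)" | (P) s where "c = suspension_class X (P, s)"
  using assms unfolding suspension_eq
  by (auto simp: subshift_eq[THEN eqset_imp_iff] class_shift_x class_shift_P)

end

section \<open>Flow equivalence of homoclinic subshifts\<close>

text \<open>The circles are matched by scaling phases with \<open>M / N\<close>. At time
  \<open>t\<close> the phase of \<open>x\<close> is \<open>t\<close> on the right and
  \<open>t + b\<close> on the left, and likewise for \<open>y\<close> with \<open>b'\<close>; the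
  end conditions say that \<open>\<theta>\<close> scales these phases.\<close>

locale homoclinic_pair = X: homoclinic x P N b K + Y: homoclinic y Q M b' K'
  for x P N b K y Q M b' K' +
  fixes \<theta> :: "real \<Rightarrow> real" and T :: real
  assumes mono: "strict_mono \<theta>" and surj: "surj \<theta>"
    and right_end: "T \<le> t \<Longrightarrow> \<theta> t = t * of_int M / of_int N"
    and left_end: "t \<le> - T \<Longrightarrow> \<theta> t = (t + of_int b) * of_int M / of_int N - of_int b'"
begin

abbreviation \<rho> :: real where "\<rho> \<equiv> of_int M / of_int N"

text \<open>On the line the coordinate is unique, so \<open>THE\<close> applies. On the circle it is
  determined only modulo \<open>N\<close>, so \<open>SOME\<close> picks a representative, whose
  choice does not affect the image by \<open>h_P\<close>.\<close>

definition h :: "(sequence \<times> real) set \<Rightarrow> (sequence \<times> real) set" where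
  "h c = (if \<exists>s. c = suspension_class X.X (x, s)
     then suspension_class Y.X (y, \<theta> (THE s. c = suspension_class X.X (x, s)))
     else suspension_class Y.X (Q, (SOME s. c = suspension_class X.X (P, s)) * \<rho>))"

lemma h_x: "h (suspension_class X.X (x, s)) = suspension_class Y.X (y, \<theta> s)"
  by (auto simp: h_def X.class_x_eq_iff)

text \<open>Two representatives differ by a multiple of \<open>N\<close>, which scales to a multiple
  of \<open>M\<close>, the period of \<open>Q\<close>.\<close>

lemma h_P: "h (suspension_class X.X (P, s)) = suspension_class Y.X (Q, s * \<rho>)"
proof -
  define r where "r = (SOME t. suspension_class X.X (P, s) = suspension_class X.X (P, t))"
  have "suspension_class X.X (P, s) = suspension_class X.X (P, r)"
    unfolding r_def by (rule someI[of _ s]) simp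
  then obtain n where "r = s - of_int (N * n)"
    using X.class_P_eq_iff by blast
  then have "r * \<rho> = s * \<rho> - of_int (M * n)"
    using X.N_pos by (simp add: left_diff_distrib diff_divide_distrib)
  then have "suspension_class Y.X (Q, s * \<rho>) = suspension_class Y.X (Q, r * \<rho>)"
    unfolding Y.class_P_eq_iff by blast
  then show ?thesis
    using X.class_x_neq_P by (auto simp: h_def r_def)
qed

text \<open>A monotone surjection of the real line has no jumps.\<close>

lemma continuous_theta: "continuous_on UNIV \<theta>"
  by (rule continuous_onI_mono) (simp_all add: surj strict_mono_less_eq[OF mono])

text \<open>A point of the spiralling line far from its middle is close to the circle, at the phase given
  by the agreement with \<open>P\<close>; the end conditions on \<open>\<theta>\<close> make its image close to the image of that
  point of the circle.\<close>

lemma class_far: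
  assumes "real_of_int (max \<bar>k\<bar> \<bar>k - b\<bar>) + of_int N * (\<bar>of_int K'\<bar> + of_int n + \<bar>of_int b'\<bar> + 1) + \<bar>T\<bar> + \<bar>s\<bar> \<le> of_int J"
    and "0 \<le> n"
    and j: "J \<le> j \<and> N dvd j - k \<or> j \<le> - J \<and> N dvd j + b - k"
  shows "\<exists>z\<in>Y.X. agree n Q z \<and>
    h (suspension_class X.X (shift_pow j x, s)) = suspension_class Y.X (z, (s + of_int k) * \<rho>)"
  using j
proof
  \<comment> \<open>The distance required in \<open>y\<close>: past \<open>K'\<close>, with room for
    a window of radius \<open>n\<close> and, on the left, for the phase shift
    \<open>b'\<close>.\<close>
  define C where "C = \<bar>K'\<bar> + n + \<bar>b'\<bar> + 1"
  have "real_of_int (max \<bar>k\<bar> \<bar>k - b\<bar> + N * C) + (\<bar>T\<bar> + \<bar>s\<bar>) \<le> of_int J"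
    using assms(1) by (simp add: C_def algebra_simps)
  moreover from this have "real_of_int (max \<bar>k\<bar> \<bar>k - b\<bar> + N * C) \<le> of_int J" by linarith
  moreover have "0 \<le> C" using \<open>0 \<le> n\<close> by (simp add: C_def)
  moreover from this have "0 \<le> N * C" using X.N_pos by simp
  ultimately have J: "max \<bar>k\<bar> \<bar>k - b\<bar> + N * C \<le> J" "\<bar>T\<bar> + \<bar>s\<bar> \<le> of_int J"
    by (simp_all only: of_int_le_iff) linarith
  {
    assume j: "J \<le> j \<and> N dvd j - k"
    then obtain q where q: "j = k + N * q" by (auto simp: dvd_def algebra_simps)
    have "N * C \<le> N * q" using j J q by linarith
    then have "C \<le> q" using X.N_pos by simp
    moreover have "q \<le> q * M" using \<open>0 \<le> C\<close> \<open>C \<le> q\<close> Y.N_pos by (simp add: mult_le_cancel_left1)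
    ultimately have qM: "C \<le> M * q" by (simp add: ac_simps)
    have "T \<le> s + of_int j" using J(2) j by linarith
    then have "\<theta> (s + of_int j) = (s + of_int j) * \<rho>"
      using right_end by simp
    \<comment> \<open>A displacement by \<open>q\<close> periods of \<open>P\<close> becomes one by
      \<open>q\<close> periods of \<open>Q\<close>. Being an integer, it moves from the time
      coordinate into a shift of \<open>y\<close>.\<close>
    also have "\<dots> = (s + of_int k) * \<rho> + of_int (M * q)"
      using X.N_pos by (simp add: q field_simps)
    finally have "h (suspension_class X.X (shift_pow j x, s)) =
        suspension_class Y.X (shift_pow (M * q) y, (s + of_int k) * \<rho>)"
      by (simp add: X.class_shift_x Y.class_shift_x h_x)
    moreover have "agree n Q (shift_pow (M * q) y)"
      unfolding agree_def shift_pow_apply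
      using qM by (auto simp: Y.right Y.P_add C_def)
    ultimately show ?thesis using Y.shift_x_in by blast
  }
  {
    assume j: "j \<le> - J \<and> N dvd j + b - k"
    then obtain q where q: "j = k - b + N * q" by (auto simp: dvd_def algebra_simps)
    have "N * q \<le> - (N * C)" using j J q by linarith
    then have "N * q \<le> N * (- C)" by simp
    then have "q \<le> - C" using X.N_pos by (simp only: mult_le_cancel_left_pos)
    moreover have "q * M \<le> q" using \<open>0 \<le> C\<close> \<open>q \<le> - C\<close> Y.N_pos by (simp add: mult_le_cancel_left2)
    ultimately have qM: "M * q \<le> - C" by (simp add: ac_simps)
    have "s + of_int j \<le> - T" using J(2) j by linarith
    then have "\<theta> (s + of_int j) = (s + of_int j + of_int b) * \<rho> - of_int b'"
      using left_end by simp
    also have "\<dots> = (s + of_int k) * \<rho> + of_int (M * q - b')"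
      using X.N_pos by (simp add: q field_simps)
    finally have "h (suspension_class X.X (shift_pow j x, s)) =
        suspension_class Y.X (shift_pow (M * q - b') y, (s + of_int k) * \<rho>)"
      by (simp add: X.class_shift_x Y.class_shift_x h_x)
    moreover have "agree n Q (shift_pow (M * q - b') y)"
      unfolding agree_def shift_pow_apply
    proof (intro allI impI)
      fix i :: int assume "\<bar>i\<bar> \<le> n"
      then have "y (i + (M * q - b')) = Q (i + (M * q - b') + b')"
        using qM by (intro Y.left) (simp add: C_def)
      then show "Q i = y (i + (M * q - b'))" by (simp add: Y.P_add)
    qed
    ultimately show ?thesis using Y.shift_x_in by blast
  }
qed

lemma h_in: "c \<in> suspension X.X \<Longrightarrow> h c \<in> suspension Y.X"
  by (elim X.suspension_cases) (auto simp: h_x h_P suspension_eq)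

text \<open>The time change is \<open>\<theta>\<close> recentred on the line and scaling on the
  circle. Its surjectivity is recorded so that whole flow lines are mapped onto whole flow
  lines.\<close>

lemma h_flow:
  assumes "c \<in> suspension X.X"
  shows "\<exists>\<tau>. continuous_on UNIV \<tau> \<and> strict_mono \<tau> \<and> surj \<tau> \<and>
    (\<forall>t. h (suspension_flow X.X t c) = suspension_flow Y.X (\<tau> t) (h c))"
  using assms
proof (cases rule: X.suspension_cases)
  case (x s)
  have "surj (\<lambda>t. \<theta> (s + t) - \<theta> s)"
  proof (rule surjI)
    fix u
    show "\<theta> (s + (inv \<theta> (u + \<theta> s) - s)) - \<theta> s = u"
      by (simp add: surj_f_inv_f[OF surj])
  qed
  moreover have "continuous_on UNIV (\<lambda>t. \<theta> (s + t) - \<theta> s)"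
    by (intro continuous_intros continuous_on_compose2[OF continuous_theta]) auto
  moreover have "strict_mono (\<lambda>t. \<theta> (s + t) - \<theta> s)"
    using mono by (simp add: strict_mono_def)
  moreover have "h (suspension_flow X.X t c) = suspension_flow Y.X (\<theta> (s + t) - \<theta> s) (h c)" for t
    by (simp add: x h_x suspension_flow_class)
  ultimately show ?thesis by blast
next
  case (P s)
  have pos: "0 < \<rho>" using X.N_pos Y.N_pos by simp
  then have "surj (\<lambda>t. t * \<rho>)"
    using X.N_pos Y.N_pos by (intro surjI[where f = "\<lambda>u. u / \<rho>"]) simp
  moreover have "continuous_on UNIV (\<lambda>t. t * \<rho>)"
    by (intro continuous_intros)
  moreover have "strict_mono (\<lambda>t. t * \<rho>)"
    using pos by (intro strict_monoI mult_strict_right_mono)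
  moreover have "h (suspension_flow X.X t c) = suspension_flow Y.X (t * \<rho>) (h c)" for t
    by (simp add: P h_P suspension_flow_class ring_distribs add_divide_distrib)
  ultimately show ?thesis by blast
qed

lemma preserves_orientation_h: "preserves_orientation X.X Y.X h"
  unfolding preserves_orientation_def using h_flow by blast

lemma h_flow_line:
  assumes "L \<in> flow_lines X.X"
  shows "h ` L \<in> flow_lines Y.X"
proof -
  obtain c where c: "c \<in> suspension X.X" "L = range (\<lambda>t. suspension_flow X.X t c)"
    using assms by (auto simp: flow_lines_def)
  then obtain \<tau> where \<tau>: "surj \<tau>" "\<And>t. h (suspension_flow X.X t c) = suspension_flow Y.X (\<tau> t) (h c)"
    using h_flow by blast
  have "h ` L = (\<lambda>t. suspension_flow Y.X t (h c)) ` range \<tau>"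
    by (simp add: c(2) image_image \<tau>(2))
  then show ?thesis using \<tau>(1) h_in[OF c(1)] by (auto simp: flow_lines_def)
qed

text \<open>The quotient map reduces this to continuity on the product, checked pointwise: off the
  periodic orbit only time varies, and at a periodic point nearby shifts of \<open>x\<close> are
  handled by \<open>class_far\<close>.\<close>

lemma continuous_map_h: "continuous_map (suspension_topology X.X) (suspension_topology Y.X) h"
proof (rule continuous_compose_quotient_map[OF quotient_map_suspension_class])
  let ?h = "h \<circ> suspension_class X.X"
  show "continuous_map (top_of_set (X.X \<times> UNIV)) (suspension_topology Y.X) ?h"
    unfolding continuous_map_def
  proof (intro conjI allI impI)
    show "?h \<in> topspace (top_of_set (X.X \<times> UNIV)) \<rightarrow> topspace (suspension_topology Y.X)"
      using h_in by (auto simp: topspace_suspension_topology suspension_eq)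
    fix V assume "openin (suspension_topology Y.X) V"
    then have "openin (top_of_set (Y.X \<times> UNIV)) {a \<in> Y.X \<times> UNIV. suspension_class Y.X a \<in> V}"
      by (simp add: openin_suspension_topology)
    then obtain U where U: "open U"
      "{a \<in> Y.X \<times> UNIV. suspension_class Y.X a \<in> V} = Y.X \<times> UNIV \<inter> U"
      unfolding openin_open by blast
    then have V_iff: "suspension_class Y.X (w, t) \<in> V \<longleftrightarrow> (w, t) \<in> U" if "w \<in> Y.X" for w t
      using that by blast
    \<comment> \<open>Product neighbourhoods inside the preimage of \<open>V\<close>; the radius is
      taken nonnegative because \<open>class_far\<close> asks for that.\<close>
    have box: "\<exists>n \<epsilon>. 0 \<le> n \<and> 0 < \<epsilon> \<and>
        (\<forall>w'\<in>Y.X. \<forall>t'. agree n w w' \<longrightarrow> \<bar>t' - t\<bar> < \<epsilon> \<longrightarrow> suspension_class Y.X (w', t') \<in> V)"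
      if "w \<in> Y.X" "suspension_class Y.X (w, t) \<in> V" for w t
    proof -
      have "(w, t) \<in> U" using V_iff that by blast
      then obtain A B where AB: "open A" "open B" "(w, t) \<in> A \<times> B" "A \<times> B \<subseteq> U"
        using open_prod_elim[OF U(1)] by blast
      obtain n where n: "\<And>w'. agree n w w' \<Longrightarrow> w' \<in> A"
        using open_contains_agree[of A w] AB by auto
      obtain \<epsilon> where "0 < \<epsilon>" and \<epsilon>: "\<And>t'. \<bar>t' - t\<bar> < \<epsilon> \<Longrightarrow> t' \<in> B"
        using AB unfolding open_dist dist_real_def by auto
      have "suspension_class Y.X (w', t') \<in> V"
        if "w' \<in> Y.X" "agree (max 0 n) w w'" "\<bar>t' - t\<bar> < \<epsilon>" for w' t'
      proof -
        have "agree n w w'" using that(2) by (rule agree_mono) simp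
        then have "(w', t') \<in> U" using n \<epsilon> that AB(4) by blast
        then show ?thesis using V_iff that(1) by blast
      qed
      then show ?thesis
        using \<open>0 < \<epsilon>\<close> by (intro exI[of _ "max 0 n"] exI[of _ \<epsilon>]) auto
    qed
    show "openin (top_of_set (X.X \<times> UNIV))
      {a \<in> topspace (top_of_set (X.X \<times> UNIV)). ?h a \<in> V}" (is "openin _ ?W")
    proof (subst openin_subopen, intro ballI)
      fix a assume a: "a \<in> ?W"
      obtain z s where zs: "a = (z, s)" by fastforce
      have "\<exists>m S. open S \<and> s \<in> S \<and> (\<forall>z'\<in>X.X. \<forall>s'\<in>S. agree m z z' \<longrightarrow> ?h (z', s') \<in> V)"
      proof -
        have "z \<in> X.X" and hV: "h (suspension_class X.X (z, s)) \<in> V" using a zs by auto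
        then consider (P) k where "z = shift_pow k P"
          | (x) k where "z = shift_pow k x" "z \<notin> range (\<lambda>k. shift_pow k P)"
          unfolding X.subshift_eq by blast
        then show ?thesis
        proof cases
          case (x k)
          obtain m where m: "\<And>j. \<not> agree m z (shift_pow j P)"
            "\<And>j. agree m z (shift_pow j x) \<Longrightarrow> shift_pow j x = z"
            using X.separation[OF x(2)] by blast
          \<comment> \<open>Here \<open>z\<close> is isolated in the subshift, so continuity of
            \<open>\<theta>\<close> alone suffices.\<close>
          then have iso: "z' = z" if "z' \<in> X.X" "agree m z z'" for z'
            using that unfolding X.subshift_eq by auto
          have "suspension_class Y.X (y, \<theta> (s + of_int k)) \<in> V"
            using hV by (simp add: x X.class_shift_x h_x)
          then obtain n \<epsilon> where \<epsilon>: "0 < \<epsilon>"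
            "\<And>w t. w \<in> Y.X \<Longrightarrow> agree n y w \<Longrightarrow> \<bar>t - \<theta> (s + of_int k)\<bar> < \<epsilon> \<Longrightarrow> suspension_class Y.X (w, t) \<in> V"
            using box[OF Y.x_in] by meson
          define S where "S = (\<lambda>t. \<theta> (t + of_int k)) -` {\<theta> (s + of_int k) - \<epsilon><..<\<theta> (s + of_int k) + \<epsilon>}"
          have "open S" unfolding S_def
            by (intro open_vimage open_greaterThanLessThan continuous_on_compose2[OF continuous_theta])
              (auto intro: continuous_intros)
          moreover have "s \<in> S" using \<epsilon>(1) by (simp add: S_def)
          moreover have "?h (z', s') \<in> V" if "z' \<in> X.X" "s' \<in> S" "agree m z z'" for z' s'
          proof -
            have "\<bar>\<theta> (s' + of_int k) - \<theta> (s + of_int k)\<bar> < \<epsilon>"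
              using that(2) by (auto simp: S_def)
            then have "suspension_class Y.X (y, \<theta> (s' + of_int k)) \<in> V"
              using \<epsilon>(2)[OF Y.x_in] by (simp add: agree_def)
            then show ?thesis using iso[OF that(1,3)] by (simp add: x X.class_shift_x h_x)
          qed
          ultimately show ?thesis by blast
        next
          case (P k)
          define u where "u = (s + of_int k) * \<rho>"
          have "suspension_class Y.X (Q, u) \<in> V"
            using hV by (simp add: P X.class_shift_P h_P u_def)
          then obtain n \<epsilon> where \<epsilon>: "0 \<le> n" "0 < \<epsilon>"
            "\<And>w t. w \<in> Y.X \<Longrightarrow> agree n Q w \<Longrightarrow> \<bar>t - u\<bar> < \<epsilon> \<Longrightarrow> suspension_class Y.X (w, t) \<in> V"
            using box[OF Y.P_in] by meson
          define S where "S = {s - 1<..<s + 1} \<inter> (\<lambda>t. (t + of_int k) * \<rho>) -` {u - \<epsilon><..<u + \<epsilon>}"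
          have "open S" unfolding S_def
            by (intro open_Int open_vimage open_greaterThanLessThan continuous_intros)
          moreover have "s \<in> S" using \<epsilon>(2) by (simp add: S_def u_def)
          moreover
          \<comment> \<open>The threshold of \<open>class_far\<close> with
            \<open>\<bar>s\<bar> + 1\<close> for the time, so that one \<open>J\<close> serves all
            \<open>s'\<close> in \<open>S\<close>.\<close>
          define J where "J = \<lceil>real_of_int (max \<bar>k\<bar> \<bar>k - b\<bar>) +
            of_int N * (\<bar>of_int K'\<bar> + of_int n + \<bar>of_int b'\<bar> + 1) + \<bar>T\<bar> + (\<bar>s\<bar> + 1)\<rceil>"
          obtain m where m: "\<And>j. agree m (shift_pow k P) (shift_pow j P) \<Longrightarrow> N dvd j - k"
            "\<And>j. agree m (shift_pow k P) (shift_pow j x) \<Longrightarrow>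
              J \<le> j \<and> N dvd j - k \<or> j \<le> - J \<and> N dvd j + b - k"
            using X.separation_P[of k J] by blast
          have "?h (z', s') \<in> V" if z': "z' \<in> X.X" "agree m z z'" and "s' \<in> S" for z' s'
          proof -
            have s': "\<bar>(s' + of_int k) * \<rho> - u\<bar> < \<epsilon>" "\<bar>s'\<bar> \<le> \<bar>s\<bar> + 1"
              using \<open>s' \<in> S\<close> by (auto simp: S_def)
            have "\<exists>w\<in>Y.X. agree n Q w \<and> ?h (z', s') = suspension_class Y.X (w, (s' + of_int k) * \<rho>)"
              using z'(1)[unfolded X.subshift_eq]
            proof
              assume "z' \<in> range (\<lambda>k. shift_pow k x)"
              then obtain j where j: "z' = shift_pow j x" by blast
              have "real_of_int (max \<bar>k\<bar> \<bar>k - b\<bar>) + of_int N * (\<bar>of_int K'\<bar> + of_int n + \<bar>of_int b'\<bar> + 1)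
                 + \<bar>T\<bar> + (\<bar>s\<bar> + 1) \<le> of_int J"
                unfolding J_def by (rule le_of_int_ceiling)
              then have "real_of_int (max \<bar>k\<bar> \<bar>k - b\<bar>) + of_int N * (\<bar>of_int K'\<bar> + of_int n + \<bar>of_int b'\<bar> + 1)
                 + \<bar>T\<bar> + \<bar>s'\<bar> \<le> of_int J"
                using s'(2) by linarith
              from class_far[OF this \<epsilon>(1) m(2)] show ?thesis
                using z'(2) by (simp add: P j)
            next
              assume "z' \<in> range (\<lambda>k. shift_pow k P)"
              then obtain j where "z' = shift_pow j P" by blast
              then have "z' = shift_pow k P"
                using m(1) z'(2) P by (simp add: X.shift_P_eq_iff)
              then show ?thesis
                by (intro bexI[of _ Q]) (auto simp: agree_def X.class_shift_P h_P)
            qed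
            then show ?thesis using \<epsilon>(3) s'(1) by auto
          qed
          ultimately show ?thesis by blast
        qed
      qed
      then obtain m S where S: "open S" "s \<in> S"
        "\<And>z' s'. z' \<in> X.X \<Longrightarrow> s' \<in> S \<Longrightarrow> agree m z z' \<Longrightarrow> ?h (z', s') \<in> V"
        by blast
      have "openin (top_of_set (X.X \<times> UNIV)) ((X.X \<times> UNIV) \<inter> ({z'. agree m z z'} \<times> S))"
        by (intro openin_open_Int open_Times open_agree S(1))
      moreover have "a \<in> (X.X \<times> UNIV) \<inter> ({z'. agree m z z'} \<times> S)"
        using a zs S(2) by (simp add: agree_def)
      moreover have "(X.X \<times> UNIV) \<inter> ({z'. agree m z z'} \<times> S) \<subseteq> ?W"
        using S(3) by auto
      ultimately show "\<exists>T. openin (top_of_set (X.X \<times> UNIV)) T \<and> a \<in> T \<and> T \<subseteq> ?W"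
        by blast
    qed
  qed
qed

end

section \<open>The inverse map\<close>

context homoclinic_pair
begin

text \<open>The setting is symmetric under swapping the two sides and inverting
  \<open>\<theta>\<close>, so continuity of the inverse map is the same lemma again.\<close>

lemma inverse_pair: "\<exists>T'. homoclinic_pair y Q M b' K' x P N b K (inv \<theta>) T'"
proof -
  \<comment> \<open>The two terms are the absolute values of \<open>\<theta> T\<close> and
    \<open>\<theta> (- T)\<close>.\<close>
  define T' where "T' = max \<bar>T * \<rho>\<bar> \<bar>(of_int b - T) * \<rho> - of_int b'\<bar>"
  have pos: "0 < \<rho>" using X.N_pos Y.N_pos by simp
  have inv_eq: "inv \<theta> u = t" if "\<theta> t = u" for t u
    using strict_mono_imp_inj_on[OF mono] that by (rule inv_f_eq)
  have "homoclinic_pair y Q M b' K' x P N b K (inv \<theta>) T'"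
  proof unfold_locales
    show "strict_mono (inv \<theta>)"
    proof (rule strict_monoI)
      fix u v :: real assume "u < v"
      then have "\<theta> (inv \<theta> u) < \<theta> (inv \<theta> v)" by (simp add: surj_f_inv_f[OF surj])
      then show "inv \<theta> u < inv \<theta> v" using strict_mono_less[OF mono] by blast
    qed
    show "surj (inv \<theta>)"
      using strict_mono_imp_inj_on[OF mono] by (rule inj_imp_surj_inv)
  next
    fix u assume "T' \<le> u"
    then have "T * \<rho> \<le> u" unfolding T'_def by linarith
    then have "T \<le> u / \<rho>" using pos by (simp only: pos_le_divide_eq)
    then have "\<theta> (u / \<rho>) = u" using right_end X.N_pos Y.N_pos by simp
    then show "inv \<theta> u = u * of_int N / of_int M" by (simp add: inv_eq)
  next
    fix u assume "u \<le> - T'"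
    then have "u \<le> (of_int b - T) * \<rho> - of_int b'" unfolding T'_def by linarith
    then have "(u + of_int b') / \<rho> \<le> of_int b - T"
      using pos by (simp only: pos_divide_le_eq)
    then have "\<theta> ((u + of_int b') / \<rho> - of_int b) = u"
      using left_end X.N_pos Y.N_pos by simp
    then show "inv \<theta> u = (u + of_int b') * of_int N / of_int M - of_int b"
      by (simp add: inv_eq)
  qed
  then show ?thesis by blast
qed

lemma flow_equivalent: "flow_equivalent X.X Y.X"
proof -
  obtain T' where "homoclinic_pair y Q M b' K' x P N b K (inv \<theta>) T'"
    using inverse_pair by blast
  then interpret I: homoclinic_pair y Q M b' K' x P N b K "inv \<theta>" T' .
  have 1: "I.h (h c) = c" if "c \<in> suspension X.X" for c
    using that strict_mono_imp_inj_on[OF mono] X.N_pos Y.N_pos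
    by (elim X.suspension_cases) (simp_all add: h_x h_P I.h_x I.h_P)
  have 2: "h (I.h c) = c" if "c \<in> suspension Y.X" for c
    using that surj X.N_pos Y.N_pos
    by (elim Y.suspension_cases) (simp_all add: h_x h_P I.h_x I.h_P surj_f_inv_f)
  have "homeomorphic_maps (suspension_topology X.X) (suspension_topology Y.X) h I.h"
    using 1 2 continuous_map_h I.continuous_map_h
    by (simp add: homeomorphic_maps_def topspace_suspension_topology)
  then show ?thesis
    unfolding flow_equivalent_def
    using homeomorphic_maps_imp_map h_flow_line preserves_orientation_h by blast
qed

end

section \<open>Constructing the reparametrization\<close>

text \<open>A linear map plus a correction that falls linearly from \<open>\<delta>\<close> to 0
  over a long interval around 0.\<close>

lemma reparametrization_exists:
  fixes \<rho> \<delta> :: real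
  assumes "0 < \<rho>"
  shows "\<exists>\<theta> T. strict_mono \<theta> \<and> surj \<theta> \<and> (\<forall>t\<ge>T. \<theta> t = t * \<rho>) \<and> (\<forall>t\<le>-T. \<theta> t = t * \<rho> + \<delta>)"
proof -
  \<comment> \<open>The correction has slope at most \<open>\<bar>\<delta>\<bar> / (2 * T)\<close>
    in absolute value; this \<open>T\<close> keeps it below \<open>\<rho>\<close>, so the sum stays
    increasing.\<close>
  define T where "T = (\<bar>\<delta>\<bar> + 1) / \<rho>"
  define \<kappa> where "\<kappa> t = max (-1) (min 1 (t / T))" for t
  define \<theta> where "\<theta> t = t * \<rho> + \<delta> * (1 - \<kappa> t) / 2" for t
  have "0 < T" using assms by (simp add: T_def)
  have \<rho>: "\<rho> = (\<bar>\<delta>\<bar> + 1) / T" using assms by (simp add: T_def)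
  have "\<theta> s < \<theta> t" if "s < t" for s t
  proof -
    have "s / T \<le> t / T" using that \<open>0 < T\<close> by (simp add: divide_right_mono)
    then have d: "\<bar>\<kappa> t - \<kappa> s\<bar> \<le> (t - s) / T"
      by (auto simp: \<kappa>_def diff_divide_distrib)
    have "\<delta> * (\<kappa> t - \<kappa> s) \<le> \<bar>\<delta>\<bar> * \<bar>\<kappa> t - \<kappa> s\<bar>" by (metis abs_ge_self abs_mult)
    also have "\<dots> \<le> \<bar>\<delta>\<bar> * ((t - s) / T)" using d by (rule mult_left_mono) simp
    also have "\<dots> < (\<bar>\<delta>\<bar> + 1) * ((t - s) / T)"
      using that \<open>0 < T\<close> by (intro mult_strict_right_mono) simp_all
    also have "\<dots> = (t - s) * \<rho>" by (simp add: \<rho>)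
    finally have "\<delta> * (\<kappa> t - \<kappa> s) < (t - s) * \<rho>" .
    moreover have "0 < (t - s) * \<rho>" using that assms by simp
    moreover have "\<theta> t - \<theta> s = (t - s) * \<rho> - \<delta> * (\<kappa> t - \<kappa> s) / 2"
      by (simp add: \<theta>_def field_simps)
    ultimately show ?thesis by linarith
  qed
  then have "strict_mono \<theta>" by (rule strict_monoI)
  moreover have "surj \<theta>"
  proof -
    \<comment> \<open>Bounded distance from a linear map gives values on both sides of any
      \<open>u\<close>, and the intermediate value theorem applies.\<close>
    have bound: "\<bar>\<theta> t - t * \<rho>\<bar> \<le> \<bar>\<delta>\<bar>" for t
    proof -
      have "\<bar>(1 - \<kappa> t) / 2\<bar> \<le> 1" by (auto simp: \<kappa>_def)
      then have "\<bar>\<delta>\<bar> * \<bar>(1 - \<kappa> t) / 2\<bar> \<le> \<bar>\<delta>\<bar>" by (rule mult_left_le) simp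
      then show ?thesis by (simp add: \<theta>_def abs_mult)
    qed
    have "\<exists>t. \<theta> t = u" for u
    proof -
      let ?s = "(u - \<bar>\<delta>\<bar>) / \<rho>" and ?t = "(u + \<bar>\<delta>\<bar>) / \<rho>"
      have "\<theta> ?s \<le> u" "u \<le> \<theta> ?t"
        using bound[of ?s] bound[of ?t] assms by auto
      moreover have "?s \<le> ?t" using assms by (simp add: divide_right_mono)
      moreover have "continuous_on {?s..?t} \<theta>"
        unfolding \<theta>_def \<kappa>_def using \<open>0 < T\<close> by (intro continuous_intros) auto
      ultimately show ?thesis using IVT'[of \<theta> ?s u ?t] by blast
    qed
    then show ?thesis by (metis surjI)
  qed
  moreover have "\<theta> t = t * \<rho>" if "T \<le> t" for t
  proof -
    have "1 \<le> t / T" using that \<open>0 < T\<close> by simp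
    then show ?thesis by (simp add: \<theta>_def \<kappa>_def)
  qed
  moreover have "\<theta> t = t * \<rho> + \<delta>" if "t \<le> - T" for t
  proof -
    have "t / T \<le> -1" using that \<open>0 < T\<close> by (simp add: pos_divide_le_eq)
    then show ?thesis by (simp add: \<theta>_def \<kappa>_def)
  qed
  ultimately show ?thesis by blast
qed

lemma homoclinic_flow_equivalent:
  assumes "homoclinic x P N b K" "homoclinic y Q M b' K'"
  shows "flow_equivalent (generated_subshift x) (generated_subshift y)"
proof -
  interpret X: homoclinic x P N b K by fact
  interpret Y: homoclinic y Q M b' K' by fact
  define \<rho> :: real where "\<rho> = of_int M / of_int N"
  have "0 < \<rho>" using X.N_pos Y.N_pos by (simp add: \<rho>_def)
  then obtain \<theta> T where \<theta>: "strict_mono \<theta>" "surj \<theta>" "\<forall>t\<ge>T. \<theta> t = t * \<rho>"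
    "\<forall>t\<le>-T. \<theta> t = t * \<rho> + (of_int b * \<rho> - of_int b')"
    using reparametrization_exists by meson
  have "homoclinic_pair x P N b K y Q M b' K' \<theta> T"
    using \<theta> by unfold_locales (simp_all add: \<rho>_def distrib_right add_divide_distrib)
  then show ?thesis by (rule homoclinic_pair.flow_equivalent)
qed

section \<open>Recognizing homoclinic sequences\<close>

text \<open>Normalization: shifting \<open>P\<close> by \<open>a\<close> makes the right phase 0 and
  the left one \<open>b - a\<close>, and the given period \<open>A\<close> is replaced by the least
  one.\<close>

lemma homoclinicI:
  assumes "0 < A" and period: "\<And>i. P (i + A) = P i"
    and right: "\<And>i. K \<le> i \<Longrightarrow> x i = P (i + a)"
    and left: "\<And>i. i \<le> L \<Longrightarrow> x i = P (i + b)"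
    and "\<not> periodic x"
  shows "\<exists>P' N c K'. homoclinic x P' N c K'"
proof -
  define P' where "P' = shift_pow a P"
  define n where "n = (LEAST n. 0 < n \<and> shift_pow (int n) P' = P')"
  have "shift_pow A P = P" using period by (simp add: shift_pow_def)
  then have "shift_pow A P' = P'" unfolding P'_def by (metis shift_pow_add add.commute)
  then have "0 < nat A \<and> shift_pow (int (nat A)) P' = P'"
    using \<open>0 < A\<close> by simp
  then have n: "0 < n \<and> shift_pow (int n) P' = P'"
    unfolding n_def by (rule LeastI)
  define N where "N = int n"
  have mult: "shift_pow (N * k) P' = P'" for k
  proof (induction k rule: int_induct[where k = 0])
    case (step1 k)
    then show ?case using n by (simp add: N_def distrib_left shift_pow_add)
  next
    case (step2 k)
    have "shift_pow (- N) P' = P'"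
      using n shift_pow_eq_iff[of 0 P' N P'] by (simp add: N_def)
    then have "shift_pow (N * k + - N) P' = P'"
      using step2 by (simp only: shift_pow_add)
    then show ?case by (simp add: right_diff_distrib)
  qed simp
  have P': "shift_pow k P' = P' \<longleftrightarrow> N dvd k" for k
  proof
    assume k: "shift_pow k P' = P'"
    \<comment> \<open>Division with remainder: \<open>k mod N\<close> is again a period, and
      minimality of \<open>n\<close> makes it 0.\<close>
    have "shift_pow k P' = shift_pow (k mod N) (shift_pow (N * (k div N)) P')"
      by (simp add: shift_pow_shift_pow)
    then have "shift_pow (int (nat (k mod N))) P' = P'"
      using k mult n by (simp add: N_def)
    moreover have "nat (k mod N) < n" using n by (simp add: N_def nat_less_iff)
    ultimately have "nat (k mod N) = 0"
      using not_less_Least[of "nat (k mod N)" "\<lambda>n. 0 < n \<and> shift_pow (int n) P' = P'"]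
      unfolding n_def [symmetric] by simp
    moreover have "0 \<le> k mod N" using n by (simp add: N_def)
    ultimately show "N dvd k" by (simp add: dvd_eq_mod_eq_0)
  next
    assume "N dvd k"
    then show "shift_pow k P' = P'" using mult by (auto simp: dvd_def)
  qed
  have aper: "k = 0" if k: "shift_pow k x = x" for k
  proof (rule ccontr)
    assume "k \<noteq> 0"
    have "shift_pow (- k) x = x" using k shift_pow_eq_iff[of 0 x k x] by simp
    \<comment> \<open>\<open>periodic\<close> speaks of positive powers only, so the sign of
      \<open>k\<close> is removed.\<close>
    then have "shift_pow \<bar>k\<bar> x = x" using k by (simp add: abs_if)
    then have "(shift ^^ nat \<bar>k\<bar>) x = x" by (simp flip: shift_pow_of_nat)
    moreover have "0 < nat \<bar>k\<bar>" using \<open>k \<noteq> 0\<close> by simp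
    ultimately show False
      using \<open>\<not> periodic x\<close> unfolding periodic_def by blast
  qed
  have "homoclinic x P' N (b - a) (max \<bar>K\<bar> \<bar>L\<bar>)"
  proof unfold_locales
    show "0 < N" using n by (simp add: N_def)
    show "x i = P' i" if "max \<bar>K\<bar> \<bar>L\<bar> \<le> i" for i
      using that by (auto simp: P'_def shift_pow_apply intro!: right)
    show "x i = P' (i + (b - a))" if "i \<le> - max \<bar>K\<bar> \<bar>L\<bar>" for i
    proof -
      have "i \<le> L" using that by auto
      then show ?thesis by (simp add: left P'_def shift_pow_apply)
    qed
  qed (fact P' aper)+
  then show ?thesis by blast
qed

lemma homoclinic_single_one: "homoclinic (\<lambda>i. i = 0) (\<lambda>_. False) 1 0 1"
proof unfold_locales
  show "k = 0" if "shift_pow k (\<lambda>i. i = 0) = (\<lambda>i. i = 0)" for k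
    using fun_cong[OF that, of 0] by (simp add: shift_pow_def)
qed (auto simp: shift_pow_def)

section \<open>Sturmian sequences with rational frequency\<close>

lemma is_cell_factor:
  assumes "is_cell (factor x a b)"
  shows "a < b" "x a" "\<And>j. a < j \<Longrightarrow> j < b \<Longrightarrow> \<not> x j" "int (zeros (factor x a b)) = b - a - 1"
proof -
  obtain k where k: "map x [a..b - 1] = True # replicate k False"
    using assms by (auto simp: is_cell_def factor_def)
  from arg_cong[OF k, of length] have len: "nat (b - a) = Suc k" by simp
  then show "a < b" by linarith
  have nth: "x (a + int n) = (True # replicate k False) ! n" if "n < Suc k" for n
  proof -
    have "map x [a..b - 1] ! n = x (a + int n)" using that len by simp
    then show ?thesis by (simp only: k)
  qed
  show "x a" using nth[of 0] by simp
  show "\<not> x j" if "a < j" "j < b" for j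
    using nth[of "nat (j - a)"] that len by (simp add: nth_Cons' nat_less_iff)
  have "count_list (replicate k False) False = k" by (induction k) simp_all
  then have "zeros (factor x a b) = k"
    unfolding zeros_def factor_def k by simp
  then show "int (zeros (factor x a b)) = b - a - 1" using len by linarith
qed

lemma strict_mono_int_diff:
  fixes p :: "int \<Rightarrow> int"
  assumes "strict_mono p" "r \<le> s"
  shows "s - r \<le> p s - p r"
  using assms(2)
proof (induction s rule: int_ge_induct)
  case (step s)
  have "p s < p (s + 1)" using assms(1) by (simp add: strict_mono_def)
  with step show ?case by linarith
qed simp

section \<open>Cell lengths, balance and mean cell length\<close>

context
  fixes x :: sequence and p :: "int \<Rightarrow> int"
  assumes series: "cell_series x p"
begin

lemma starts_strict_mono: "strict_mono p"
  using series by (simp add: cell_series_def)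

lemma cell_is_cell: "is_cell (factor x (p i) (p (i + 1)))"
  using series by (simp add: cell_series_def cell_def)

text \<open>The cells cover all positions because \<open>p\<close> is unbounded in both directions,
  and a cell has its only 1 at its start.\<close>

lemma ones_eq_starts: "x i \<longleftrightarrow> i \<in> range p"
proof
  have "\<exists>r. p r \<le> i \<and> i < p (r + 1)"
  proof -
    \<comment> \<open>Starts are at least one apart, so going back
      \<open>\<bar>i - p 0\<bar>\<close> cells from \<open>p 0\<close> reaches a start not beyond
      \<open>i\<close>; the cell containing \<open>i\<close> is then found by induction
      upwards.\<close>
    have low: "p (- \<bar>i - p 0\<bar>) \<le> i"
      using strict_mono_int_diff[OF starts_strict_mono, of "- \<bar>i - p 0\<bar>" 0] by simp
    then show ?thesis
    proof (induction i rule: int_ge_induct)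
      case base
      then show ?case
        using is_cell_factor(1)[OF cell_is_cell] by blast
    next
      case (step i)
      then obtain r where r: "p r \<le> i" "i < p (r + 1)" by blast
      show ?case
      proof (cases "i + 1 < p (r + 1)")
        case True
        with r show ?thesis by (intro exI[of _ r]) simp
      next
        case False
        with r have "i + 1 = p (r + 1)" by simp
        then show ?thesis
          using is_cell_factor(1)[OF cell_is_cell, of "r + 1"] by (intro exI[of _ "r + 1"]) simp
      qed
    qed
  qed
  then obtain r where r: "p r \<le> i" "i < p (r + 1)" by blast
  assume "x i"
  then have "i = p r"
    using is_cell_factor(3)[OF cell_is_cell, of r i] r by force
  then show "i \<in> range p" by blast
next
  assume "i \<in> range p"
  then show "x i" using is_cell_factor(2)[OF cell_is_cell] by auto
qed

lemma zeros_chain: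
  assumes "r \<le> s"
  shows "int (zeros (concat (map (cell x p) [r..s - 1]))) = p s - p r - (s - r)"
  using assms
proof (induction s rule: int_ge_induct)
  case base
  then show ?case by (simp add: zeros_def)
next
  case (step s)
  have "[r..s + 1 - 1] = [r..s - 1] @ [s]" using step.hyps upto_rec2[of r s] by simp
  then have "int (zeros (concat (map (cell x p) [r..s + 1 - 1]))) =
      int (zeros (concat (map (cell x p) [r..s - 1]))) + int (zeros (cell x p s))"
    by (simp only:) (simp add: zeros_def)
  also have "int (zeros (cell x p s)) = p (s + 1) - p s - 1"
    unfolding cell_def by (rule is_cell_factor(4)[OF cell_is_cell])
  finally show ?case using step.IH by simp
qed

lemma is_chain_segment:
  assumes "0 < m"
  shows "is_chain x m (concat (map (cell x p) [r..r + int m - 1]))"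
  unfolding is_chain_def
  using series assms by (intro conjI exI[of _ p] exI[of _ r] exI[of _ "r + int m - 1"]) auto

text \<open>Chains of \<open>m\<close> cells all contain \<open>m\<close> ones, so their lengths
  differ exactly as their numbers of zeros do.\<close>

lemma sturmian_balanced:
  assumes "sturmian x" "0 < m"
  shows "\<bar>(p (r + int m) - p r) - (p (s + int m) - p s)\<bar> \<le> 1"
proof -
  have "\<bar>int (zeros (concat (map (cell x p) [r..r + int m - 1]))) -
      int (zeros (concat (map (cell x p) [s..s + int m - 1])))\<bar> \<le> 1"
    using assms is_chain_segment unfolding sturmian_def by blast
  then show ?thesis by (simp add: zeros_chain)
qed

text \<open>The mean cell length is the frequency plus one, each cell contributing its single
  1.\<close>

lemma frequency_tendsto:
  assumes "has_frequency x \<alpha>"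
  shows "(\<lambda>n. of_int (p (int n) - p 0) / real n) \<longlonglongrightarrow> \<alpha> + 1"
proof -
  define w where "w n = concat (map (cell x p) [0..0 + int n - 1])" for n
  have "is_chain x n (w n)" if "1 \<le> n" for n
    unfolding w_def using that by (intro is_chain_segment) simp
  then have "(\<lambda>n. real (zeros (w n)) / real n) \<longlonglongrightarrow> \<alpha>"
    using assms unfolding has_frequency_def by blast
  then have "(\<lambda>n. real (zeros (w n)) / real n + 1) \<longlonglongrightarrow> \<alpha> + 1"
    by (intro tendsto_intros)
  moreover have "real (zeros (w n)) / real n + 1 = of_int (p (int n) - p 0) / real n"
    if "1 \<le> n" for n
  proof -
    have "int (zeros (w n)) = p (int n) - p 0 - int n"
      unfolding w_def using zeros_chain[of 0 "int n"] by simp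
    then have "real_of_int (int (zeros (w n))) = of_int (p (int n) - p 0 - int n)"
      by (simp only:)
    then show ?thesis using that by (simp add: field_simps)
  qed
  then have "\<forall>\<^sub>F n in sequentially.
      real (zeros (w n)) / real n + 1 = of_int (p (int n) - p 0) / real n"
    using eventually_ge_at_top[of 1] by (rule eventually_mono[rotated])
  ultimately show ?thesis by (rule Lim_transform_eventually)
qed

text \<open>By balance, \<open>n\<close> consecutive blocks of \<open>m\<close> cells have total
  length within \<open>n\<close> of \<open>n * d\<close>. Dividing by \<open>n\<close> and passing
  to the limit compares \<open>d\<close> with the mean.\<close>

lemma slope_bound_of_nat:
  assumes "sturmian x" "has_frequency x \<alpha>"
  shows "\<bar>of_int (p (r + int m) - p r) - (\<alpha> + 1) * real m\<bar> \<le> 1"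
proof (cases "m = 0")
  case False
  define d where "d = p (r + int m) - p r"
  have sum: "\<bar>p (int (n * m)) - p 0 - int n * d\<bar> \<le> int n" for n
  proof (induction n)
    case (Suc n)
    have "\<bar>(p (int (n * m) + int m) - p (int (n * m))) - d\<bar> \<le> 1"
      unfolding d_def using False by (intro sturmian_balanced[OF assms(1)]) simp
    moreover have "int (Suc n * m) = int (n * m) + int m" by simp
    moreover have "int (Suc n) * d = int n * d + d" by (simp add: distrib_right)
    ultimately show ?case using Suc by (simp only:)
  qed simp
  have "(\<lambda>n. of_int (p (int (n * m)) - p 0) / real (n * m)) \<longlonglongrightarrow> \<alpha> + 1"
    using False by (intro filterlim_compose[OF frequency_tendsto[OF assms(2)]] mult_nat_right_at_top) simp
  then have lim: "(\<lambda>n. \<bar>of_int d - of_int (p (int (n * m)) - p 0) / real (n * m) * real m\<bar>)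
      \<longlonglongrightarrow> \<bar>of_int d - (\<alpha> + 1) * real m\<bar>"
    by (intro tendsto_intros)
  have "\<bar>of_int d - of_int (p (int (n * m)) - p 0) / real (n * m) * real m\<bar> \<le> 1" if "1 \<le> n" for n
  proof -
    have "\<bar>real_of_int (p (int (n * m)) - p 0 - int n * d)\<bar> \<le> of_int (int n)"
      using sum[of n] by (simp only: of_int_abs [symmetric] of_int_le_iff)
    then have "\<bar>real n * of_int d - real_of_int (p (int (n * m)) - p 0)\<bar> \<le> real n"
      by (simp add: abs_minus_commute)
    moreover have "of_int d - of_int (p (int (n * m)) - p 0) / real (n * m) * real m
      = (real n * of_int d - of_int (p (int (n * m)) - p 0)) / real n"
      using that False by (simp add: field_simps)
    ultimately show ?thesis using that by (simp add: abs_divide)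
  qed
  then have "\<forall>\<^sub>F n in sequentially.
      \<bar>of_int d - of_int (p (int (n * m)) - p 0) / real (n * m) * real m\<bar> \<le> 1"
    using eventually_ge_at_top[of 1] by (rule eventually_mono[rotated])
  with lim show ?thesis
    unfolding d_def by (intro tendsto_upperbound) auto
qed simp

end

section \<open>Deviation from a line of rational slope\<close>

text \<open>\<open>A / B\<close> is the mean cell length; \<open>slope\<close> says that starts stay
  within distance one of a line of that slope, with denominators cleared so that everything is an
  integer.\<close>

locale rational_slope =
  fixes p :: "int \<Rightarrow> int" and A B :: int
  assumes strict_mono: "strict_mono p"
    and B_pos: "0 < B" and coprime: "coprime A B"
    and balanced: "\<bar>(p (r + B) - p r) - (p (s + B) - p s)\<bar> \<le> 1"
    and slope: "\<bar>(B * p s - A * s) - (B * p r - A * r)\<bar> \<le> B"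
begin

definition deviation :: "int \<Rightarrow> int" where
  "deviation r = B * p r - A * r"

lemma deviation_bound: "\<bar>deviation s - deviation r\<bar> \<le> B"
  using slope by (simp add: deviation_def)

lemma deviation_step: "deviation (r + B) - deviation r = B * (p (r + B) - p r - A)"
  by (simp add: deviation_def algebra_simps)

text \<open>The deviation is monotone along each residue class modulo \<open>B\<close>, in steps of \<open>B\<close>, with the
  same direction for all classes. Two jumps in one class would exceed its bound.\<close>

lemma deviation_jump_unique:
  assumes "deviation (r + B) \<noteq> deviation r" "deviation (s + B) \<noteq> deviation s"
    and "B dvd s - r" "r < s"
  shows False
proof -
  \<comment> \<open>The jump over \<open>B\<close> cells in units of \<open>B\<close>; the deviation
    bound leaves only the values -1, 0 and 1.\<close>
  define \<epsilon> where "\<epsilon> u = p (u + B) - p u - A" for u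
  have step: "deviation (u + B) - deviation u = B * \<epsilon> u" for u
    by (simp add: deviation_step \<epsilon>_def)
  have "\<bar>\<epsilon> u\<bar> \<le> 1" for u
  proof -
    have "B * \<bar>\<epsilon> u\<bar> \<le> B * 1"
      using deviation_bound[of "u + B" u] B_pos by (simp add: step abs_mult)
    then show ?thesis using B_pos by (simp only: mult_le_cancel_left_pos)
  qed
  moreover have "\<epsilon> r \<noteq> 0" "\<epsilon> s \<noteq> 0" using assms(1,2) step[of r] step[of s] by auto
  moreover have close: "\<bar>\<epsilon> u - \<epsilon> v\<bar> \<le> 1" for u v
    using balanced[of u v] by (simp add: \<epsilon>_def)
  \<comment> \<open>Balance lets any two jumps differ by at most one, so none has the sign opposite
    to \<open>\<epsilon> r\<close>.\<close>
  ultimately have \<sigma>: "\<bar>\<epsilon> r\<bar> = 1" "\<epsilon> s = \<epsilon> r" "0 \<le> \<epsilon> r * \<epsilon> u" for u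
    by (smt (verit, best) close zero_le_mult_iff)+
  \<comment> \<open>Between the two jumps the deviation cannot move back, so their effects add up to
    at least \<open>2 * B\<close>.\<close>
  have grow: "0 \<le> \<epsilon> r * (deviation (r + B + int n * B) - deviation (r + B))" for n
  proof (induction n)
    case (Suc n)
    have "r + B + int (Suc n) * B = (r + B + int n * B) + B" by (simp add: algebra_simps)
    then have "\<epsilon> r * (deviation (r + B + int (Suc n) * B) - deviation (r + B)) =
        \<epsilon> r * (deviation (r + B + int n * B) - deviation (r + B)) + B * (\<epsilon> r * \<epsilon> (r + B + int n * B))"
      using step[of "r + B + int n * B"] by (simp only:) (simp add: algebra_simps)
    then show ?case using Suc \<sigma>(3) B_pos by simp
  qed simp
  obtain k where k: "s - r = B * k" using assms(3) by (auto simp: dvd_def)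
  then have "0 < k" using \<open>r < s\<close> B_pos by (metis diff_gt_0_iff_gt zero_less_mult_pos)
  then have "s = r + B + int (nat (k - 1)) * B" using k by (simp add: algebra_simps)
  then have "0 \<le> \<epsilon> r * (deviation s - deviation (r + B))" using grow by metis
  then have "2 * B \<le> \<epsilon> r * (deviation (s + B) - deviation s) +
      \<epsilon> r * (deviation s - deviation (r + B)) + \<epsilon> r * (deviation (r + B) - deviation r)"
    using \<sigma>(1,2) by (auto simp: step abs_if split: if_splits)
  also have "\<dots> = \<epsilon> r * (deviation (s + B) - deviation r)" by (simp add: algebra_simps)
  also have "\<dots> \<le> \<bar>deviation (s + B) - deviation r\<bar>"
    using \<sigma>(1) by (metis abs_ge_self abs_mult mult_1)
  also have "\<dots> \<le> B" by (rule deviation_bound)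
  finally show False using B_pos by simp
qed

text \<open>Each of the \<open>B\<close> residue classes has at most one jump.\<close>

lemma deviation_jumps_finite: "finite {r. deviation (r + B) \<noteq> deviation r}"
proof -
  have "inj_on (\<lambda>r. r mod B) {r. deviation (r + B) \<noteq> deviation r}"
  proof (rule inj_onI, rule ccontr)
    fix r s
    assume *: "r \<in> {r. deviation (r + B) \<noteq> deviation r}" "s \<in> {r. deviation (r + B) \<noteq> deviation r}"
      "r mod B = s mod B" "r \<noteq> s"
    then have "B dvd s - r" "B dvd r - s" by (metis mod_eq_dvd_iff)+
    then show False
      using * deviation_jump_unique[of r s] deviation_jump_unique[of s r] by force
  qed
  moreover have "(\<lambda>r. r mod B) ` {r. deviation (r + B) \<noteq> deviation r} \<subseteq> {0..<B}"
    using B_pos by auto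
  then have "finite ((\<lambda>r. r mod B) ` {r. deviation (r + B) \<noteq> deviation r})"
    by (rule finite_subset) simp
  ultimately show ?thesis by (rule finite_imageD[rotated])
qed

text \<open>With finitely many jumps, none remains outside a bounded interval, and steps of length
  \<open>B\<close> connect the members of a residue class within either tail.\<close>

lemma deviation_eq_tails:
  "\<exists>L\<ge>0. \<forall>r s. (L \<le> r \<and> L \<le> s \<or> r \<le> - L \<and> s \<le> - L) \<longrightarrow> B dvd s - r \<longrightarrow> deviation s = deviation r"
proof -
  have "finite (abs ` {r. deviation (r + B) \<noteq> deviation r})"
    using deviation_jumps_finite by simp
  then obtain L0 where L0: "\<And>r. deviation (r + B) \<noteq> deviation r \<Longrightarrow> \<bar>r\<bar> \<le> L0"
    using bdd_above_finite[of "abs ` {r. deviation (r + B) \<noteq> deviation r}"]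
    by (auto simp: bdd_above_def)
  define L where "L = \<bar>L0\<bar> + 1"
  have const: "deviation (r + B) = deviation r" if "L \<le> \<bar>r\<bar>" for r
    using L0[of r] that by (force simp: L_def)
  have iter: "deviation (r + int n * B) = deviation r" if "L \<le> r \<or> r + int n * B \<le> - L" for r n
    using that
  proof (induction n)
    case (Suc n)
    have e: "r + int (Suc n) * B = (r + int n * B) + B" by (simp add: algebra_simps)
    have "0 \<le> int n * B" using B_pos by simp
    then have "L \<le> \<bar>r + int n * B\<bar>" "L \<le> r \<or> r + int n * B \<le> - L"
      using Suc.prems B_pos unfolding e by linarith+
    then show ?case using Suc.IH const unfolding e by simp
  qed simp
  have le: "deviation s = deviation r"
    if "L \<le> r \<and> L \<le> s \<or> r \<le> - L \<and> s \<le> - L" "B dvd s - r" "r \<le> s" for r s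
  proof -
    from that(2) obtain k where k: "s - r = B * k" by (auto simp: dvd_def)
    then have "0 \<le> k" using that(3) B_pos by (metis diff_ge_0_iff_ge zero_le_mult_iff not_less)
    then have "s = r + int (nat k) * B" using k by (simp add: algebra_simps)
    then show ?thesis using iter[of r "nat k"] that(1) by metis
  qed
  have "deviation s = deviation r"
    if tails: "L \<le> r \<and> L \<le> s \<or> r \<le> - L \<and> s \<le> - L" and dvd: "B dvd s - r" for r s
  proof (cases "r \<le> s")
    case True
    with tails dvd show ?thesis by (rule le)
  next
    case False
    have "B dvd r - s" using dvd by (metis dvd_minus_iff minus_diff_eq)
    then show ?thesis using le[of s r] tails False by auto
  qed
  moreover have "0 \<le> L" by (simp add: L_def)
  ultimately show ?thesis by blast
qed

text \<open>On \<open>S\<close> two deviations differ by less than \<open>B\<close>, so the one at \<open>r\<close> is determined by its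
  residue \<open>- A r\<close> modulo \<open>B\<close>.\<close>

lemma mechanical_on:
  assumes "S \<noteq> {}" and dev: "\<And>r s. r \<in> S \<Longrightarrow> s \<in> S \<Longrightarrow> B dvd s - r \<Longrightarrow> deviation s = deviation r"
  shows "\<exists>a t. \<forall>r\<in>S. p r = A * (r + a) div B + t"
proof -
  have lt: "\<bar>deviation s - deviation r\<bar> < B" if "r \<in> S" "s \<in> S" for r s
  proof (rule ccontr)
    assume "\<not> \<bar>deviation s - deviation r\<bar> < B"
    \<comment> \<open>A difference of exactly \<open>B\<close> would put \<open>r\<close> and
      \<open>s\<close> in one residue class, by coprimality, where the deviation is constant on
      \<open>S\<close>.\<close>
    then have eq: "\<bar>deviation s - deviation r\<bar> = B" using deviation_bound[of s r] by simp
    then have "B dvd deviation s - deviation r" by (metis dvd_abs_iff dvd_refl)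
    moreover have "A * (s - r) = B * (p s - p r) - (deviation s - deviation r)"
      by (simp add: deviation_def algebra_simps)
    ultimately have "B dvd A * (s - r)" by (metis dvd_diff dvd_triv_left)
    then have "B dvd s - r"
      using coprime by (simp add: coprime_dvd_mult_right_iff coprime_commute)
    then show False using dev[OF that] eq B_pos by simp
  qed
  obtain r1 where "r1 \<in> S" using assms(1) by blast
  \<comment> \<open>The offset makes the deviation nonnegative on \<open>S\<close>, so that a
    minimum exists by well-ordering of the naturals.\<close>
  define f where "f r = nat (deviation r - (deviation r1 - B))" for r
  obtain r0 where r0: "r0 \<in> S" "\<And>r. r \<in> S \<Longrightarrow> f r0 \<le> f r"
    using ex_has_least_nat[of "\<lambda>r. r \<in> S" r1 f] \<open>r1 \<in> S\<close> by blast
  have min: "deviation r0 \<le> deviation r" if "r \<in> S" for r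
    using r0(2)[OF that] lt[OF \<open>r1 \<in> S\<close> that] by (simp add: f_def)
  \<comment> \<open>With \<open>r0\<close> minimal, \<open>c - deviation r\<close> lies between 0
    and \<open>B - 1\<close> on \<open>S\<close>, so \<open>p r\<close> is the floor of
    \<open>(A * r + c) / B\<close>.\<close>
  define c where "c = deviation r0 + B - 1"
  \<comment> \<open>Bezout splits the intercept \<open>c\<close> into an index shift and a position
    shift, so both tails are compared with the same line through the origin.\<close>
  obtain u v where "u * A + v * B = 1"
    using bezout_int[of A B] coprime by auto
  then have c: "c = A * (u * c) + B * (v * c)"
    by (metis distrib_right mult.assoc mult.commute mult_1)
  have "p r = A * (r + u * c) div B + v * c" if "r \<in> S" for r
  proof -
    have "0 \<le> A * r + c - B * p r" "A * r + c - B * p r < B"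
      using min[OF that] lt[OF r0(1) that] by (auto simp: c_def deviation_def)
    then have "(A * r + c - B * p r + p r * B) div B = p r"
      using B_pos by (simp only: div_mult_self1) simp
    then have "p r = (A * r + c) div B" by (simp add: mult.commute)
    also have "A * r + c = A * (r + u * c) + v * c * B"
      using c by (simp add: algebra_simps)
    also have "\<dots> div B = A * (r + u * c) div B + v * c" using B_pos by simp
    finally show ?thesis .
  qed
  then show ?thesis by blast
qed

text \<open>\<open>P\<close> marks the values of the floor of \<open>A * r / B\<close>. Since only
  the range matters, the index shift from \<open>mechanical_on\<close> disappears and the position
  shift becomes the phase.\<close>

lemma eventually_mechanical:
  assumes x: "\<And>i. x i \<longleftrightarrow> i \<in> range p"
  defines "P \<equiv> \<lambda>i. \<exists>r. i = A * r div B"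
  shows "0 < A" "P (i + A) = P i"
    "\<exists>K L a b. (\<forall>i\<ge>K. x i = P (i + a)) \<and> (\<forall>i\<le>L. x i = P (i + b))"
proof -
  obtain L where L: "0 \<le> L"
    "\<And>r s. (L \<le> r \<and> L \<le> s \<or> r \<le> - L \<and> s \<le> - L) \<Longrightarrow> B dvd s - r \<Longrightarrow> deviation s = deviation r"
    using deviation_eq_tails by blast
  \<comment> \<open>No jump at \<open>L\<close> means that the \<open>B\<close> cells from there
    have total length exactly \<open>A\<close>, which is therefore positive.\<close>
  have "B * (p (L + B) - p L - A) = 0"
    using L(2)[of L "L + B"] deviation_step[of L] B_pos by simp
  moreover have "p L < p (L + B)" using strict_mono B_pos by (simp add: strict_mono_def)
  ultimately show A: "0 < A" using B_pos by simp
  show "P (i + A) = P i"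
  proof
    assume "P (i + A)"
    then obtain r where "i + A = A * r div B" by (auto simp: P_def)
    then have "i = (A * (r - B) + A * B) div B - A" by (simp add: algebra_simps)
    then have "i = A * (r - B) div B" using B_pos by simp
    then show "P i" by (auto simp: P_def)
  next
    assume "P i"
    then obtain r where "i = A * r div B" by (auto simp: P_def)
    then have "i + A = (A * r + A * B) div B" using B_pos by simp
    then have "i + A = A * (r + B) div B" by (simp add: algebra_simps)
    then show "P (i + A)" by (auto simp: P_def)
  qed
  obtain a t where right: "\<And>r. L \<le> r \<Longrightarrow> p r = A * (r + a) div B + t"
    using mechanical_on[of "{L..}"] L(2) by auto
  obtain b u where left: "\<And>r. r \<le> - L \<Longrightarrow> p r = A * (r + b) div B + u"
    using mechanical_on[of "{..- L}"] L(2) by auto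
  have mono: "A * r div B \<le> A * s div B" if "r \<le> s" for r s
    using that A B_pos by (intro zdiv_mono1 mult_left_mono) auto
  have "x i = P (i + (- t))" if i: "p L \<le> i" for i
  proof
    assume "x i"
    then obtain r where r: "i = p r" using x by blast
    then have "L \<le> r" using i strict_mono by (simp add: strict_mono_less_eq)
    then show "P (i + (- t))" using right[of r] r by (auto simp: P_def)
  next
    assume "P (i + (- t))"
    then obtain r where r: "i - t = A * r div B" by (auto simp: P_def)
    show "x i"
    proof (cases "L \<le> r - a")
      case True
      then have "i = p (r - a)" using right[of "r - a"] r by simp
      then show ?thesis using x by blast
    next
      case False
      \<comment> \<open>An index before the tail gives a value at most \<open>p L - t\<close>, while
        \<open>i\<close> is at least \<open>p L\<close>; so it can only hit the boundary.\<close>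
      then have "i = p L" using mono[of r "L + a"] right[of L] r i by simp
      then show ?thesis using x by blast
    qed
  qed
  moreover have "x i = P (i + (- u))" if i: "i \<le> p (- L)" for i
  proof
    assume "x i"
    then obtain r where r: "i = p r" using x by blast
    then have "r \<le> - L" using i strict_mono by (simp add: strict_mono_less_eq)
    then show "P (i + (- u))" using left[of r] r by (auto simp: P_def)
  next
    assume "P (i + (- u))"
    then obtain r where r: "i - u = A * r div B" by (auto simp: P_def)
    show "x i"
    proof (cases "r - b \<le> - L")
      case True
      then have "i = p (r - b)" using left[of "r - b"] r by simp
      then show ?thesis using x by blast
    next
      case False
      then have "i = p (- L)" using mono[of "- L + b" r] left[of "- L"] r i by simp
      then show ?thesis using x by blast
    qed
  qed
  ultimately show "\<exists>K L a b. (\<forall>i\<ge>K. x i = P (i + a)) \<and> (\<forall>i\<le>L. x i = P (i + b))"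
    by blast
qed

end

section \<open>From skew Sturmian to homoclinic sequences\<close>

lemma sturmian_rational_slope:
  assumes "sturmian x" "has_frequency x \<alpha>" "\<alpha> \<in> \<rat>" and series: "cell_series x p"
  shows "\<exists>A B. rational_slope p A B"
proof -
  have "\<alpha> + 1 \<in> \<rat>" using assms(3) by simp
  then obtain A B where AB: "0 < B" "coprime A B" "\<alpha> + 1 = of_int A / of_int B"
    by (rule Rats_cases')
  have slope_le: "\<bar>(B * p s - A * s) - (B * p r - A * r)\<bar> \<le> B" if "r \<le> s" for r s
  proof -
    have "\<bar>of_int (p s - p r) - (of_int A / of_int B) * real_of_int (s - r)\<bar> \<le> 1"
      using slope_bound_of_nat[OF series assms(1,2), of r "nat (s - r)"] that
      by (simp add: AB(3))
    then have "of_int B * \<bar>of_int (p s - p r) - (of_int A / of_int B) * real_of_int (s - r)\<bar> \<le> of_int B"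
      using AB(1) by (simp add: mult_left_le)
    also have "of_int B * \<bar>of_int (p s - p r) - (of_int A / of_int B) * real_of_int (s - r)\<bar> =
        \<bar>of_int B * (of_int (p s - p r) - (of_int A / of_int B) * real_of_int (s - r))\<bar>"
      using AB(1) by (simp add: abs_mult)
    also have "of_int B * (of_int (p s - p r) - (of_int A / of_int B) * real_of_int (s - r)) =
        real_of_int ((B * p s - A * s) - (B * p r - A * r))"
      using AB(1) by (simp add: field_simps)
    finally show ?thesis by (simp only: of_int_abs [symmetric] of_int_le_iff)
  qed
  have "rational_slope p A B"
  proof
    show "strict_mono p" using series by (rule starts_strict_mono)
    show "\<bar>(p (r + B) - p r) - (p (s + B) - p s)\<bar> \<le> 1" for r s
      using sturmian_balanced[OF series assms(1), of "nat B" r s] AB(1) by simp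
    show "\<bar>(B * p s - A * s) - (B * p r - A * r)\<bar> \<le> B" for r s
      using slope_le[of r s] slope_le[of s r] by (cases "r \<le> s") (auto simp: abs_minus_commute)
  qed (use AB in auto)
  then show ?thesis by blast
qed

text \<open>The auxiliary \<open>z\<close> serves the case of frequency infinity, where
  \<open>x\<close> is only similar to the sequence with its single 1 at 0; similar sequences
  generate the same subshift.\<close>

lemma skew_sturmian_homoclinic:
  assumes "skew_sturmian x"
  shows "\<exists>z P N b K. homoclinic z P N b K \<and> generated_subshift z = generated_subshift x"
  using assms unfolding skew_sturmian_def
proof (elim disjE conjE bexE)
  fix \<alpha> assume x: "sturmian x" "\<not> periodic x" "\<alpha> \<in> \<rat>" "has_frequency x \<alpha>"
  then obtain p where p: "cell_series x p" by (auto simp: sturmian_def)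
  then obtain A B where "rational_slope p A B"
    using sturmian_rational_slope x by blast
  then interpret rational_slope p A B .
  note mech = eventually_mechanical[of x, OF ones_eq_starts[OF p]]
  obtain K L a b where
    "\<forall>i\<ge>K. x i = (\<exists>r. i + a = A * r div B)" "\<forall>i\<le>L. x i = (\<exists>r. i + b = A * r div B)"
    using mech(3) by blast
  then have "\<exists>P N b K. homoclinic x P N b K"
    using homoclinicI[of A "\<lambda>i. \<exists>r. i = A * r div B" K x a L b] mech(1,2) x(2) by blast
  then show ?thesis by blast
next
  assume "similar x (\<lambda>i. i = 0)"
  then show ?thesis
    using homoclinic_single_one generated_subshift_shift unfolding similar_def by metis
qed

theorem corollary3p7:
  fixes X Y :: "sequence set"
  assumes "skew_sturmian_subshift X" and "skew_sturmian_subshift Y"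
  shows "flow_equivalent X Y"
  using assms skew_sturmian_homoclinic homoclinic_flow_equivalent
  unfolding skew_sturmian_subshift_def by metis

end
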